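(* Let $\gamma$ be a closed loop on $\Lambda=(\mathbb{Z}/N\mathbb{Z})^4$ that bounds an oriented lattice surface, and let $v\in\mathbb{Z}$ and the expectation values of the dyonic Wilson loop $W_d$ and dual dyonic Wilson loop $\tilde W_d$ be as in the context. Then for all $\beta>0$, $\theta\in\mathbb{R}$, $p\in\mathbb{Z}$ and $q_e,q_m\in\mathbb{Z}$, $$\langle W_d^{(q_e-q_m,q_m)}(\gamma)\rangle^p_{\beta,\theta+2\pi}=\langle W_d^{(q_e,q_m)}(\gamma)\rangle^{p+1}_{\beta,\theta}=(-1)^{q_m^2v}\,\langle W_d^{(q_e,q_m)}(\gamma)\rangle^{p}_{\beta,\theta},$$ $$\langle\tilde W_d^{(q_e-q_m,q_m)}(\gamma)\rangle^p_{\beta,\theta+2\pi}=\langle\tilde W_d^{(q_e,q_m)}(\gamma)\rangle^{p+1}_{\beta,\theta}=(-1)^{q_m^2v}\,\langle\tilde W_d^{(q_e,q_m)}(\gamma)\rangle^{p}_{\beta,\theta}.$$ Thus the shift $\theta\to\theta+2\pi$ acts on the charges by $(q_e,q_m)\mapsto(q_e-q_m,q_m)$.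
   Context: Lattice and forms. $\Lambda=(\mathbb{Z}/N\mathbb{Z})^4$, $N\ge1$, unit vectors $\hat\mu$ ($\mu=1,\dots,4$). An $r$-form $\alpha$ assigns $\alpha_{x,\mu_1\cdots\mu_r}$ to each site $x$ and indices $\mu_i$, antisymmetric in the indices. For $r$-forms, $\alpha\cdot\beta=\sum_x\sum_{\mu_1<\dots<\mu_r}\alpha_{x,\mu_1\cdots\mu_r}\beta_{x,\mu_1\cdots\mu_r}$. For an $r$-form $\alpha$: $(d\alpha)_{x,\mu_1\cdots\mu_{r+1}}=\sum_{j}(-1)^{j+1}[\alpha_{x+\hat\mu_j,\mu_1\cdots\mathring\mu_j\cdots\mu_{r+1}}-\alpha_{x,\mu_1\cdots\mathring\mu_j\cdots\mu_{r+1}}]$ ($\mathring\mu_j$ omitted), $(\partial\alpha)_{x,\mu_1\cdots\mu_{r-1}}=\sum_{\nu=1}^4[\alpha_{x,\mu_1\cdots\mu_{r-1}\nu}-\alpha_{x-\hat\nu,\mu_1\cdots\mu_{r-1}\nu}]$. Cup product of an $r$-form and a $t$-form: $(\alpha\cup\beta)_{x,\mu_1\cdots\mu_{r+t}}=\sum_{\sigma\in\mathfrak S_{r+t}}\frac{\mathrm{sgn}\,\sigma}{r!\,t!}\alpha_{x,\mu_{\sigma(1)}\cdots\mu_{\sigma(r)}}\beta_{x+\hat\mu_{\sigma(1)}+\cdots+\hat\mu_{\sigma(r)},\mu_{\sigma(r+1)}\cdots\mu_{\sigma(r+t)}}$. For a 4-form $\omega$, $\sum_x\omega$ means $\sum_x\omega_{x,1234}$.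 Higher cup product: for $\mu_1<\dots<\mu_{r+t-1}$, $(\alpha\cup_1\beta)_{x,\mu_1\cdots\mu_{r+t-1}}=(-1)^t\sum_{a=1}^{r+t-1}(-1)^a\big[R_{\mu_a}(R_{\mu_a}\iota_{\mu_a}\alpha\cup R_{\mu_a}\iota_{\mu_a}\beta)\big]_{x,\mu_1\cdots\mathring\mu_a\cdots\mu_{r+t-1}}$, where $(\iota_\mu\alpha)_{x,\mu_1\cdots\mu_{k}}=\alpha_{x,\mu\mu_1\cdots\mu_{k}}$; $R_\mu$ acts on sites by reversing the sign of coordinates $x_\mu,x_{\mu+1},\dots,x_4$; and on a $k$-form, for $\mu_1<\dots<\mu_k$ and $b$ with $\mu_{b-1}<\mu\le\mu_b$ ($b=k+1$ if all $\mu_i<\mu$), $(R_\mu\alpha)_{x,\mu_1\cdots\mu_k}=(-1)^{k-b+1}\alpha_{R_\mu x-\sum_{i=b}^k\hat\mu_i,\mu_1\cdots\mu_k}$. Theory. Fields: 1-form $A^e$ and 3-form $A^m$ with components in $[-\pi,\pi)$, integer-valued 2-form $n$; $F^e=dA^e+2\pi n$. Define $Q[F^e]=\sum_x\big(\frac1{8\pi^2}F^e\cup F^e+\frac1{4\pi}F^e\cup_1dn\big)$, $\tilde Q[F^e]=\sum_x\big(\frac1{8\pi^2}F^e\cup F^e-\frac1{4\pi}F^e\cup_1dn\big)$, and the (integer) Pontryagin square $\mathfrak P(n)=\sum_x(n\cup n+n\cup_1dn)$. Measures: $\int DA^e=\prod_{x,\mu}\int_{-\pi}^\pi\frac{dA^e_{x,\mu}}{2\pi}$,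 $\int DA^m=\prod_x\prod_{\mu<\nu<\rho}\int_{-\pi}^\pi\frac{dA^m_{x,\mu\nu\rho}}{2\pi}$; $\sum_{\{n\}}$ runs over all integer 2-forms. Partition function: $Z[\beta,\theta]=\int DA^eDA^m\sum_{\{n\}}\exp(-\frac\beta2F^e\cdot F^e-\frac{i\theta}{8\pi^2}\sum_xF^e\cup F^e+\frac{i}{2\pi}\partial A^m\cdot F^e)$. Loops. $\gamma$ is a closed loop of oriented links, each link traversed at most once; $\dot\gamma$ is the 1-form with $\dot\gamma_{x,\mu}=1$ if $\gamma$ contains the link from $x$ to $x+\hat\mu$, $-1$ if it contains that link with reversed orientation, $0$ otherwise. For charges $q_e,q_m\in\mathbb{Z}$: $W_d^{(q_e,q_m)}(\gamma)=\exp\big(i(q_e\,\dot\gamma\cdot A^e-q_m\sum_x\dot\gamma\cup A^m)\big)$ and $\tilde W_d^{(q_e,q_m)}(\gamma)=\exp\big(i(q_e\,\dot\gamma\cdot A^e+q_m\sum_xA^m\cup\dot\gamma)\big)$. For $p\in\mathbb{Z}$ (only $p$ mod 2 matters), $$\langle W_d^{(q_e,q_m)}(\gamma)\rangle^p_{\beta,\theta}=\frac1{Z[\beta,\theta]}\int DA^eDA^m\sum_{\{n\}}e^{-\frac\beta2F^e\cdot F^e-i\theta Q[F^e]+\frac i{2\pi}\partial A^m\cdot F^e-ip\pi\mathfrak P(n)}\,W_d^{(q_e,q_m)}(\gamma),$$ and $\langle\tilde W_d^{(q_e,q_m)}(\gamma)\rangle^p_{\beta,\theta}$ is defined by the same formula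 with $Q$ replaced by $\tilde Q$ and $W_d$ by $\tilde W_d$. Number $v$. Since $\gamma$ bounds, there is an integer-valued 2-form $l$ with $\epsilon_{\mu\nu\rho\sigma}(dl)_{x+\hat\mu,\nu\rho\sigma}=-\dot\gamma_{x,\mu}$ for all $x$, $\mu$ and $\nu<\rho<\sigma$ the three remaining indices. Fix such an $l$ and set $v=\mathfrak P(l)\in\mathbb{Z}$. *)

theory Defs
  imports
    "HOL-Analysis.Analysis"
    "HOL-Combinatorics.Permutations"
    "Berlekamp_Zassenhaus.Finite_Field"
begin

section \<open>Directions and the periodic lattice\<close>

datatype dir = D1 | D2 | D3 | D4

primrec dir_index :: "dir \<Rightarrow> nat" where
  "dir_index D1 = 1"
| "dir_index D2 = 2"
| "dir_index D3 = 3"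
| "dir_index D4 = 4"

lemma dir_index_inject: "dir_index \<mu> = dir_index \<nu> \<longleftrightarrow> \<mu> = \<nu>"
  by (cases \<mu>; cases \<nu>) simp_all

instantiation dir :: linorder
begin

definition "\<mu> \<le> \<nu> \<longleftrightarrow> dir_index \<mu> \<le> dir_index \<nu>"

definition "\<mu> < \<nu> \<longleftrightarrow> dir_index \<mu> < dir_index \<nu>"

instance
  by standard (auto simp: less_eq_dir_def less_dir_def dir_index_inject)

end

lemma UNIV_dir: "(UNIV :: dir set) = {D1, D2, D3, D4}"
  by (auto intro: dir.exhaust)

instance dir :: finite
  by standard (simp add: UNIV_dir)

text \<open>The type \<open>'n mod_ring\<close> is \<open>\<int>/N\<int>\<close> with \<open>N = CARD('n)\<close>; as \<open>'n\<close> ranges over the finite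
  types, \<open>N\<close> ranges over all positive integers. The residue class of 1 is written
  \<open>of_int_mod_ring 1\<close> because the constant \<open>1\<close> is only available for \<open>N > 1\<close>.\<close>

type_synonym 'n site = "'n mod_ring ^ dir"

definition unit_vec :: "dir \<Rightarrow> ('n::finite) site" where
  "unit_vec \<mu> = axis \<mu> (of_int_mod_ring 1)"

section \<open>Forms\<close>

text \<open>An \<open>r\<close>-form is an antisymmetric function of \<open>r\<close> indices; as a normalisation it takes the
  value 0 on index lists of any other length, so that equality of forms is equality of functions.\<close>

type_synonym 'n form = "'n site \<Rightarrow> dir list \<Rightarrow> real"

definition is_form :: "nat \<Rightarrow> ('n::finite) form \<Rightarrow> bool" where
  "is_form r \<alpha> \<longleftrightarrow>
     (\<forall>x \<mu>s. length \<mu>s \<noteq> r \<longrightarrow> \<alpha> x \<mu>s = 0) \<and>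
     (\<forall>x \<mu>s i j. i < j \<and> j < length \<mu>s \<longrightarrow> \<alpha> x (\<mu>s[i := \<mu>s ! j, j := \<mu>s ! i]) = - \<alpha> x \<mu>s)"

definition int_forms :: "nat \<Rightarrow> ('n::finite) form set" where
  "int_forms r = {\<alpha>. is_form r \<alpha> \<and> (\<forall>x \<mu>s. \<alpha> x \<mu>s \<in> \<int>)}"

definition increasing_indices :: "nat \<Rightarrow> dir list set" where
  "increasing_indices r = {\<mu>s. length \<mu>s = r \<and> sorted_wrt (<) \<mu>s}"

definition levi_civita :: "dir list \<Rightarrow> real" where
  "levi_civita \<mu>s =
     (if distinct \<mu>s then (-1) ^ card {(i, j). i < j \<and> j < length \<mu>s \<and> \<mu>s ! j < \<mu>s ! i} else 0)"

definition omit :: "nat \<Rightarrow> 'a list \<Rightarrow> 'a list" where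
  "omit j xs = take j xs @ drop (Suc j) xs"

definition form_dot :: "nat \<Rightarrow> ('n::finite) form \<Rightarrow> 'n form \<Rightarrow> real" where
  "form_dot r \<alpha> \<beta> = (\<Sum>x\<in>UNIV. \<Sum>\<mu>s\<in>increasing_indices r. \<alpha> x \<mu>s * \<beta> x \<mu>s)"

definition lattice_sum :: "('n::finite) form \<Rightarrow> real" where
  "lattice_sum \<omega> = (\<Sum>x\<in>UNIV. \<omega> x [D1, D2, D3, D4])"

text \<open>Positions in index lists are counted from 0 here, which turns \<open>(-1)\<^sup>j\<^sup>+\<^sup>1\<close> with
  \<open>j = 1, \<dots>, r + 1\<close> into \<open>(-1)\<^sup>j\<close> with \<open>j = 0, \<dots>, r\<close>.\<close>

definition ext_d :: "('n::finite) form \<Rightarrow> 'n form" where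
  "ext_d \<alpha> x \<mu>s =
     (\<Sum>j<length \<mu>s. (-1) ^ j * (\<alpha> (x + unit_vec (\<mu>s ! j)) (omit j \<mu>s) - \<alpha> x (omit j \<mu>s)))"

definition codiff :: "('n::finite) form \<Rightarrow> 'n form" where
  "codiff \<alpha> x \<mu>s = (\<Sum>\<nu>\<in>UNIV. \<alpha> x (\<mu>s @ [\<nu>]) - \<alpha> (x - unit_vec \<nu>) (\<mu>s @ [\<nu>]))"

section \<open>Cup products\<close>

definition cup :: "nat \<Rightarrow> nat \<Rightarrow> ('n::finite) form \<Rightarrow> 'n form \<Rightarrow> 'n form" where
  "cup r t \<alpha> \<beta> x \<mu>s =
     (if length \<mu>s = r + t then
        \<Sum>\<sigma> | \<sigma> permutes {..<r + t}.
          of_int (sign \<sigma>) / (fact r * fact t)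
            * \<alpha> x (map (\<lambda>i. \<mu>s ! \<sigma> i) [0..<r])
            * \<beta> (x + (\<Sum>i<r. unit_vec (\<mu>s ! \<sigma> i))) (map (\<lambda>i. \<mu>s ! \<sigma> i) [r..<r + t])
      else 0)"

definition contract :: "dir \<Rightarrow> ('n::finite) form \<Rightarrow> 'n form" where
  "contract \<mu> \<alpha> x \<mu>s = \<alpha> x (\<mu> # \<mu>s)"

definition reflect_site :: "dir \<Rightarrow> ('n::finite) site \<Rightarrow> 'n site" where
  "reflect_site \<mu> x = (\<chi> i. if \<mu> \<le> i then - (x $ i) else x $ i)"

text \<open>For \<open>\<mu>\<^sub>1 < \<dots> < \<mu>\<^sub>k\<close> the indices at positions \<open>b, \<dots>, k\<close> are exactly those that are
  \<open>\<ge> \<mu>\<close>. Expressed in this way the formula does not depend on the order of the indices, so it is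
  also the antisymmetric extension to arbitrary index lists.\<close>

definition reflect_form :: "dir \<Rightarrow> ('n::finite) form \<Rightarrow> 'n form" where
  "reflect_form \<mu> \<alpha> x \<mu>s =
     (let up = filter (\<lambda>\<nu>. \<mu> \<le> \<nu>) \<mu>s
      in (-1) ^ length up * \<alpha> (reflect_site \<mu> x - sum_list (map unit_vec up)) \<mu>s)"

text \<open>Again positions are counted from 0. The formula is antisymmetric in \<open>\<mu>s\<close> and thus valid for
  arbitrary, not only increasing, index lists.\<close>

definition cup1 :: "nat \<Rightarrow> nat \<Rightarrow> ('n::finite) form \<Rightarrow> 'n form \<Rightarrow> 'n form" where
  "cup1 r t \<alpha> \<beta> x \<mu>s =
     (-1) ^ t * (\<Sum>a<length \<mu>s. (-1) ^ Suc a *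
        (let \<mu> = \<mu>s ! a
         in reflect_form \<mu>
              (cup (r - 1) (t - 1)
                 (reflect_form \<mu> (contract \<mu> \<alpha>)) (reflect_form \<mu> (contract \<mu> \<beta>)))
              x (omit a \<mu>s)))"

section \<open>The gauge theory\<close>

definition pontryagin :: "('n::finite) form \<Rightarrow> real" where
  "pontryagin n = lattice_sum (cup 2 2 n n) + lattice_sum (cup1 2 3 n (ext_d n))"

definition field_strength :: "('n::finite) form \<Rightarrow> 'n form \<Rightarrow> 'n form" where
  "field_strength Ae n x \<mu>s = ext_d Ae x \<mu>s + 2 * pi * n x \<mu>s"

definition top_charge :: "('n::finite) form \<Rightarrow> 'n form \<Rightarrow> real" where
  "top_charge F n = 1 / (8 * pi\<^sup>2) * lattice_sum (cup 2 2 F F)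
                  + 1 / (4 * pi) * lattice_sum (cup1 2 3 F (ext_d n))"

definition dual_top_charge :: "('n::finite) form \<Rightarrow> 'n form \<Rightarrow> real" where
  "dual_top_charge F n = 1 / (8 * pi\<^sup>2) * lattice_sum (cup 2 2 F F)
                       - 1 / (4 * pi) * lattice_sum (cup1 2 3 F (ext_d n))"

text \<open>The independent components of an \<open>r\<close>-form are those with increasing indices. The measure
  \<open>gauge_measure r\<close> is the product over these components of \<open>dA / (2\<pi>)\<close> on \<open>[-\<pi>, \<pi>)\<close>, and
  \<open>form_of r\<close> extends a family of components to the form it determines.\<close>

definition components :: "nat \<Rightarrow> (('n::finite) site \<times> dir list) set" where
  "components r = UNIV \<times> increasing_indices r"

definition form_of :: "nat \<Rightarrow> (('n::finite) site \<times> dir list \<Rightarrow> real) \<Rightarrow> 'n form" where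
  "form_of r A x \<mu>s = (if length \<mu>s = r then levi_civita \<mu>s * A (x, sort \<mu>s) else 0)"

definition gauge_measure :: "nat \<Rightarrow> (('n::finite) site \<times> dir list \<Rightarrow> real) measure" where
  "gauge_measure r = PiM (components r) (\<lambda>_. uniform_measure lborel {-pi..<pi})"

definition path_integral ::
  "(('n::finite) form \<Rightarrow> 'n form \<Rightarrow> 'n form \<Rightarrow> complex) \<Rightarrow> complex" where
  "path_integral f =
     (LINT A|(gauge_measure 1 \<Otimes>\<^sub>M gauge_measure 3).
        infsum (\<lambda>n. f (form_of 1 (fst A)) (form_of 3 (snd A)) n) (int_forms 2))"

definition partition_function :: "('n::finite) itself \<Rightarrow> real \<Rightarrow> real \<Rightarrow> complex" where
  "partition_function _ \<beta> \<theta> =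
     path_integral (\<lambda>(Ae :: 'n form) Am n.
       let F = field_strength Ae n
       in exp (- of_real (\<beta> / 2 * form_dot 2 F F)
               - \<i> * of_real (\<theta> / (8 * pi\<^sup>2) * lattice_sum (cup 2 2 F F))
               + \<i> * of_real (1 / (2 * pi) * form_dot 2 (codiff Am) F)))"

text \<open>The argument \<open>Q\<close> is the topological charge coupled to \<open>\<theta>\<close>, and \<open>W\<close> is the observable.\<close>

definition correlator ::
  "(('n::finite) form \<Rightarrow> 'n form \<Rightarrow> real) \<Rightarrow> ('n form \<Rightarrow> 'n form \<Rightarrow> complex)
     \<Rightarrow> int \<Rightarrow> real \<Rightarrow> real \<Rightarrow> complex" where
  "correlator Q W p \<beta> \<theta> =
     path_integral (\<lambda>Ae Am n.
       let F = field_strength Ae n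
       in exp (- of_real (\<beta> / 2 * form_dot 2 F F)
               - \<i> * of_real (\<theta> * Q F n)
               + \<i> * of_real (1 / (2 * pi) * form_dot 2 (codiff Am) F)
               - \<i> * of_real (of_int p * pi * pontryagin n))
          * W Ae Am)
     / partition_function TYPE('n) \<beta> \<theta>"

section \<open>Loops\<close>

text \<open>The oriented link \<open>(x, \<mu>, True)\<close> runs from \<open>x\<close> to \<open>x + \<mu>\<close>, and \<open>(x, \<mu>, False)\<close> is the same
  link with reversed orientation. Links are not encoded by pairs of end points since these do not
  determine the link when \<open>N \<le> 2\<close>.\<close>

type_synonym 'n link = "'n site \<times> dir \<times> bool"

fun link_source :: "('n::finite) link \<Rightarrow> 'n site" where
  "link_source (x, \<mu>, fwd) = (if fwd then x else x + unit_vec \<mu>)"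

fun link_target :: "('n::finite) link \<Rightarrow> 'n site" where
  "link_target (x, \<mu>, fwd) = (if fwd then x + unit_vec \<mu> else x)"

definition closed_loop :: "('n::finite) link list \<Rightarrow> bool" where
  "closed_loop \<gamma> \<longleftrightarrow>
     (\<forall>i<length \<gamma>. link_target (\<gamma> ! i) = link_source (\<gamma> ! (Suc i mod length \<gamma>))) \<and>
     distinct (map (\<lambda>(x, \<mu>, fwd). (x, \<mu>)) \<gamma>)"

definition loop_form :: "('n::finite) link list \<Rightarrow> 'n form" where
  "loop_form \<gamma> x \<mu>s =
     (case \<mu>s of
        [\<mu>] \<Rightarrow> if (x, \<mu>, True) \<in> set \<gamma> then 1 else if (x, \<mu>, False) \<in> set \<gamma> then -1 else 0
      | _ \<Rightarrow> 0)"

text \<open>An oriented lattice surface is represented by the integer 2-form that counts its plaquettes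
  with orientation; with the above convention, \<open>codiff\<close> is then the boundary operator: a single
  plaquette \<open>(x, \<mu>\<nu>)\<close> has the boundary \<open>x \<rightarrow> x + \<mu> \<rightarrow> x + \<mu> + \<nu> \<rightarrow> x + \<nu> \<rightarrow> x\<close>.\<close>

definition bounds_surface :: "('n::finite) link list \<Rightarrow> bool" where
  "bounds_surface \<gamma> \<longleftrightarrow> (\<exists>S\<in>int_forms 2. codiff S = loop_form \<gamma>)"

definition dual_to_loop :: "('n::finite) form \<Rightarrow> 'n link list \<Rightarrow> bool" where
  "dual_to_loop l \<gamma> \<longleftrightarrow>
     (\<forall>x \<mu>. \<forall>\<nu>s\<in>increasing_indices 3. \<mu> \<notin> set \<nu>s \<longrightarrow>
        levi_civita (\<mu> # \<nu>s) * ext_d l (x + unit_vec \<mu>) \<nu>s = - loop_form \<gamma> x [\<mu>])"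

definition dyonic_loop ::
  "int \<Rightarrow> int \<Rightarrow> ('n::finite) link list \<Rightarrow> 'n form \<Rightarrow> 'n form \<Rightarrow> complex" where
  "dyonic_loop qe qm \<gamma> Ae Am =
     exp (\<i> * of_real (of_int qe * form_dot 1 (loop_form \<gamma>) Ae
                     - of_int qm * lattice_sum (cup 1 3 (loop_form \<gamma>) Am)))"

definition dual_dyonic_loop ::
  "int \<Rightarrow> int \<Rightarrow> ('n::finite) link list \<Rightarrow> 'n form \<Rightarrow> 'n form \<Rightarrow> complex" where
  "dual_dyonic_loop qe qm \<gamma> Ae Am =
     exp (\<i> * of_real (of_int qe * form_dot 1 (loop_form \<gamma>) Ae
                     + of_int qm * lattice_sum (cup 3 1 Am (loop_form \<gamma>))))"

definition dyonic_vev ::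
  "int \<Rightarrow> int \<Rightarrow> ('n::finite) link list \<Rightarrow> int \<Rightarrow> real \<Rightarrow> real \<Rightarrow> complex" where
  "dyonic_vev qe qm \<gamma> = correlator top_charge (dyonic_loop qe qm \<gamma>)"

definition dual_dyonic_vev ::
  "int \<Rightarrow> int \<Rightarrow> ('n::finite) link list \<Rightarrow> int \<Rightarrow> real \<Rightarrow> real \<Rightarrow> complex" where
  "dual_dyonic_vev qe qm \<gamma> = correlator dual_top_charge (dual_dyonic_loop qe qm \<gamma>)"

end

theory Submission
  imports Defs "HOL-Probability.Probability"
begin

text \<open>Written in terms of \<open>n\<close>, the phase coupling \<open>A\<^sup>m\<close> is \<open>exp (- i A\<^sup>m \<cdot> dn)\<close>, and the magnetic part of the
  loop adds \<open>i q\<^sub>m A\<^sup>m \<cdot> dl\<close> (for the dual loop, with \<open>l\<close> translated by the vector \<open>(1,1,1,1)\<close>). Integrating out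
  \<open>A\<^sup>m\<close> therefore imposes \<open>dn = q\<^sub>m dl\<close>, and it suffices to compare integrands on that set. There, the
  Leibniz rule for the \<open>cup1\<close> product gives \<open>2\<pi>Q = \<pi> pontryagin n - q\<^sub>m \<gamma> \<cdot> A\<^sup>e\<close>, up to a multiple of \<open>2\<pi>\<close>
  for the dual charge: this is the shift of the electric charge. Moreover \<open>n - q\<^sub>m l\<close> is closed, and the
  intersection form of the torus is even, so \<open>pontryagin n\<close> is congruent to \<open>q\<^sub>m\<^sup>2 pontryagin l\<close> modulo 2.

  All lattice sums of products are expanded into the correlation sums \<open>corr\<close> of single components, which
  turns identities between them into linear arithmetic.\<close>

section \<open>Cup products in components\<close>

text \<open>The integrands need not agree pointwise: they are comparable only on the support of a
  delta function that appears after integrating over \<open>A\<^sup>m\<close>. The analytic task is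
  therefore to exchange the infinite sum over \<open>n\<close> with the integral. Since the weight
  contains \<open>n\<close> only through \<open>dA\<^sup>e + 2\<pi>n\<close>, the domination has to
  be uniform in \<open>A\<^sup>e\<close>; this is where \<open>\<beta> > 0\<close> and the bounded
  range of the angles enter.

  The algebraic obstacle is that the lattice cup product is not commutative, and every term with
  \<open>cup1\<close> is there to repair this. Evenness of the intersection form is proved without
  computing the cohomology of the torus: gauge fixing along one direction already splits a closed
  form into two isotropic closed pieces and an exact one. The same evenness is needed a second time,
  for the normalisation: the action of the partition function has no \<open>cup1\<close> term, and
  its periodicity in \<theta> rests on \<open>n \<union> n\<close> summing to an even integer for
  closed \<open>n\<close>.\<close>

lemma sum_permutes_three:
  fixes G :: "int \<Rightarrow> nat \<Rightarrow> nat \<Rightarrow> nat \<Rightarrow> real"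
  shows "(\<Sum>\<sigma> | \<sigma> permutes {..<3}. G (sign \<sigma>) (\<sigma> 0) (\<sigma> 1) (\<sigma> 2)) =
     G 1 0 1 2 + G (-1) 0 2 1 + G (-1) 1 0 2 + G 1 1 2 0 +
     G 1 2 0 1 + G (-1) 2 1 0"
proof -
  have set: "{..<3::nat} = {0,1,2}" by auto
  have f0: "finite {1,2::nat}" "0 \<notin> {1,2::nat}" by auto
  have f1: "finite {2::nat}" "1 \<notin> {2::nat}" by auto
  show ?thesis
    unfolding set
    unfolding sum_over_permutations_insert[OF f0]
    unfolding sum_over_permutations_insert[OF f1]
    unfolding permutes_sing
    by (simp add: sign_swap_id permutation_swap_id permutation_compose sign_compose sign_id
        swap_id_eq Transposition.transpose_def)
qed

text \<open>The sign is an argument of \<open>G\<close>, so that the summand of \<open>cup\<close>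
  becomes an instance and the whole sum collapses in one rewrite step.\<close>

lemma sum_permutes_four:
  fixes G :: "int \<Rightarrow> nat \<Rightarrow> nat \<Rightarrow> nat \<Rightarrow> nat \<Rightarrow> real"
  shows "(\<Sum>\<sigma> | \<sigma> permutes {..<4}. G (sign \<sigma>) (\<sigma> 0) (\<sigma> 1) (\<sigma> 2) (\<sigma> 3)) =
     G 1 0 1 2 3 + G (-1) 0 1 3 2 + G (-1) 0 2 1 3 + G 1 0 2 3 1 +
     G 1 0 3 1 2 + G (-1) 0 3 2 1 + G (-1) 1 0 2 3 + G 1 1 0 3 2 +
     G 1 1 2 0 3 + G (-1) 1 2 3 0 + G (-1) 1 3 0 2 + G 1 1 3 2 0 +
     G 1 2 0 1 3 + G (-1) 2 0 3 1 + G (-1) 2 1 0 3 + G 1 2 1 3 0 +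
     G 1 2 3 0 1 + G (-1) 2 3 1 0 + G (-1) 3 0 1 2 + G 1 3 0 2 1 +
     G 1 3 1 0 2 + G (-1) 3 1 2 0 + G (-1) 3 2 0 1 + G 1 3 2 1 0"
proof -
  have set: "{..<4::nat} = {0,1,2,3}" by auto
  have f0: "finite {1,2,3::nat}" "0 \<notin> {1,2,3::nat}" by auto
  have f1: "finite {2,3::nat}" "1 \<notin> {2,3::nat}" by auto
  have f2: "finite {3::nat}" "2 \<notin> {3::nat}" by auto
  show ?thesis
    unfolding set
    unfolding sum_over_permutations_insert[OF f0]
    unfolding sum_over_permutations_insert[OF f1]
    unfolding sum_over_permutations_insert[OF f2]
    unfolding permutes_sing
    by (simp add: sign_swap_id permutation_swap_id permutation_compose sign_compose sign_id
        swap_id_eq Transposition.transpose_def)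
qed

section \<open>Translations by integer vectors\<close>

lemma of_int_mod_ring_add:
  "of_int_mod_ring (a + b) = (of_int_mod_ring a + of_int_mod_ring b :: 'n::finite mod_ring)"
  by transfer (simp add: mod_simps)

lemma of_int_mod_ring_zero: "of_int_mod_ring 0 = (0 :: 'n::finite mod_ring)"
  by transfer simp

text \<open>Offsets are integers, not residues, so that composed translations are normalised by
  integer arithmetic without knowing \<open>N\<close>. Different offsets may denote the same
  translation, as in \<open>shift_period\<close>.\<close>

definition shift :: "int \<Rightarrow> int \<Rightarrow> int \<Rightarrow> int \<Rightarrow> 'n::finite site" where
  "shift p q r s = (\<chi> i. of_int_mod_ring (case i of D1 \<Rightarrow> p | D2 \<Rightarrow> q | D3 \<Rightarrow> r | D4 \<Rightarrow> s))"

lemma shift_add: "shift p q r s + shift p' q' r' s' = shift (p + p') (q + q') (r + r') (s + s')"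
  by (auto simp: shift_def vec_eq_iff of_int_mod_ring_add split: dir.split)

lemma shift_add_assoc:
  "x + shift p q r s + shift p' q' r' s' = x + shift (p + p') (q + q') (r + r') (s + s')"
  by (simp add: add.assoc shift_add)

lemma shift_zero: "shift 0 0 0 0 = 0"
  by (auto simp: shift_def vec_eq_iff of_int_mod_ring_zero split: dir.split)

lemma shift_minus: "- shift p q r s = shift (- p) (- q) (- r) (- s)"
  using shift_add[of p q r s "- p" "- q" "- r" "- s"]
  by (simp add: shift_zero eq_neg_iff_add_eq_0 neg_eq_iff_add_eq_0)

lemma shift_diff: "x - shift p q r s = x + shift (- p) (- q) (- r) (- s)"
  by (simp add: shift_minus[symmetric])

lemma unit_vec_shift:
  "unit_vec D1 = shift 1 0 0 0" "unit_vec D2 = shift 0 1 0 0"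
  "unit_vec D3 = shift 0 0 1 0" "unit_vec D4 = shift 0 0 0 1"
  by (auto simp: shift_def unit_vec_def axis_def vec_eq_iff of_int_mod_ring_zero split: dir.split)

lemma sum_translate:
  fixes f :: "'n::finite site \<Rightarrow> 'b::comm_monoid_add"
  shows "(\<Sum>x\<in>UNIV. f (x + c)) = (\<Sum>x\<in>UNIV. f x)"
  by (rule sum.reindex_bij_witness[where i="\<lambda>x. x - c" and j="\<lambda>x. x + c"]) auto

lemmas shift_simps = unit_vec_shift shift_add shift_add_assoc shift_diff

section \<open>Correlation sums and sorted components\<close>

definition corr :: "'n::finite form \<Rightarrow> dir list \<Rightarrow> 'n form \<Rightarrow> dir list \<Rightarrow> int \<Rightarrow> int \<Rightarrow> int \<Rightarrow> int \<Rightarrow> real"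
  where "corr a I b J p q r s = (\<Sum>x\<in>UNIV. a x I * b (x + shift p q r s) J)"

text \<open>By periodicity only the relative offset of the two factors matters. With
  \<open>corr_commute\<close> to fix the order of the factors, this gives a normal form for bilinear
  lattice sums.\<close>

lemma corr_sum:
  "(\<Sum>x\<in>UNIV. a (x + shift p q r s) I * b (x + shift p' q' r' s') J)
     = corr a I b J (p' - p) (q' - q) (r' - r) (s' - s)"
  "(\<Sum>x\<in>UNIV. a (x + shift p q r s) I * b x J) = corr a I b J (- p) (- q) (- r) (- s)"
  "(\<Sum>x\<in>UNIV. a x I * b (x + shift p q r s) J) = corr a I b J p q r s"
  "(\<Sum>x\<in>UNIV. a x I * b x J) = corr a I b J 0 0 0 0"
proof -
  show 1: "(\<Sum>x\<in>UNIV. a (x + shift p q r s) I * b (x + shift p' q' r' s') J)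
     = corr a I b J (p' - p) (q' - q) (r' - r) (s' - s)" for p q r s p' q' r' s'
    using sum_translate[of "\<lambda>x. a x I * b (x + shift (p' - p) (q' - q) (r' - r) (s' - s)) J"
        "shift p q r s"]
    by (simp add: corr_def shift_simps)
  show "(\<Sum>x\<in>UNIV. a (x + shift p q r s) I * b x J) = corr a I b J (- p) (- q) (- r) (- s)"
    using 1[of p q r s 0 0 0 0] by (simp add: shift_zero)
qed (simp_all add: corr_def shift_zero)

lemma corr_commute: "corr a I b J p q r s = corr b J a I (- p) (- q) (- r) (- s)"
  using corr_sum(2)[where a=b and b=a and I=J and J=I and p=p and q=q and r=r and s=s]
  by (simp add: corr_def mult.commute)

lemma form2_swap:
  assumes "is_form 2 a"
  shows "a x [j, i] = - a x [i, j]"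
  using assms[unfolded is_form_def, THEN conjunct2, rule_format, of 0 1 "[i, j]" x] by simp

lemma form3_swap:
  assumes "is_form 3 a"
  shows "a x [j, i, k] = - a x [i, j, k]" "a x [i, k, j] = - a x [i, j, k]"
  using assms[unfolded is_form_def, THEN conjunct2, rule_format, of 0 1 "[i, j, k]" x]
    assms[unfolded is_form_def, THEN conjunct2, rule_format, of 1 2 "[i, j, k]" x]
  by (simp_all add: numeral_2_eq_2)

lemma dir_less [simp]: "D1 < D2" "D1 < D3" "D1 < D4" "D2 < D3" "D2 < D4" "D3 < D4"
  "\<not> D2 < D1" "\<not> D3 < D1" "\<not> D4 < D1" "\<not> D3 < D2" "\<not> D4 < D2" "\<not> D4 < D3"
  "D1 \<le> D2" "D1 \<le> D3" "D1 \<le> D4" "D2 \<le> D3" "D2 \<le> D4" "D3 \<le> D4"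
  "\<not> D2 \<le> D1" "\<not> D3 \<le> D1" "\<not> D4 \<le> D1" "\<not> D3 \<le> D2" "\<not> D4 \<le> D2" "\<not> D4 \<le> D3"
  by (simp_all add: less_dir_def less_eq_dir_def)

text \<open>The guard orients the swap towards increasing index lists, so that it terminates as a
  rewrite rule.\<close>

lemma form2_sort:
  assumes "is_form 2 a"
  shows "i < j \<Longrightarrow> a x [j, i] = - a x [i, j]"
  using form2_swap[OF assms] by metis

lemma form3_sort:
  assumes "is_form 3 a"
  shows "i < j \<Longrightarrow> a x [j, i, k] = - a x [i, j, k]" "j < k \<Longrightarrow> a x [i, k, j] = - a x [i, j, k]"
  using form3_swap[OF assms] by metis+

section \<open>Top components of the products\<close>

lemma cup_2_2_top:
  assumes a: "is_form 2 a" and b: "is_form 2 b"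
  shows "cup 2 2 a b x [D1, D2, D3, D4] =
      a x [D1, D2] * b (x + shift 1 1 0 0) [D3, D4] - a x [D1, D3] * b (x + shift 1 0 1 0) [D2, D4]
    + a x [D1, D4] * b (x + shift 1 0 0 1) [D2, D3] + a x [D2, D3] * b (x + shift 0 1 1 0) [D1, D4]
    - a x [D2, D4] * b (x + shift 0 1 0 1) [D1, D3] + a x [D3, D4] * b (x + shift 0 0 1 1) [D1, D2]"
proof -
  let ?m = "[D1, D2, D3, D4]"
  \<comment> \<open>The divisor is \<open>fact 2 * fact 2\<close>: each of the six terms of the
    result arises from four permutations, which differ by reordering indices within \<open>a\<close>
    and within \<open>b\<close>.\<close>
  define G where "G s i j k l = real_of_int s / 4 * a x [?m ! i, ?m ! j]
     * b (x + unit_vec (?m ! i) + unit_vec (?m ! j)) [?m ! k, ?m ! l]" for s i j k l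
  have "cup 2 2 a b x ?m = (\<Sum>\<sigma> | \<sigma> permutes {..<4}. G (sign \<sigma>) (\<sigma> 0) (\<sigma> 1) (\<sigma> 2) (\<sigma> 3))"
    unfolding cup_def G_def
    by (simp add: upt_rec numeral_2_eq_2[symmetric] lessThan_nat_numeral lessThan_Suc add_ac fact_numeral)
  then show ?thesis
    unfolding sum_permutes_four
    by (simp add: G_def form2_sort[OF a] form2_sort[OF b] shift_simps)
qed

lemma cup_1_3_top:
  assumes b: "is_form 3 b"
  shows "cup 1 3 a b x [D1, D2, D3, D4] =
      a x [D1] * b (x + shift 1 0 0 0) [D2, D3, D4] - a x [D2] * b (x + shift 0 1 0 0) [D1, D3, D4]
       + a x [D3] * b (x + shift 0 0 1 0) [D1, D2, D4] - a x [D4] * b (x + shift 0 0 0 1) [D1, D2, D3]"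
proof -
  let ?m = "[D1, D2, D3, D4]"
  define G where "G s i j k l = real_of_int s / 6 * a x [?m ! i]
     * b (x + unit_vec (?m ! i)) [?m ! j, ?m ! k, ?m ! l]" for s i j k l
  have "cup 1 3 a b x ?m = (\<Sum>\<sigma> | \<sigma> permutes {..<4}. G (sign \<sigma>) (\<sigma> 0) (\<sigma> 1) (\<sigma> 2) (\<sigma> 3))"
    unfolding cup_def G_def
    by (simp add: upt_rec numeral_2_eq_2[symmetric] numeral_3_eq_3[symmetric]
        lessThan_nat_numeral lessThan_Suc add_ac fact_numeral)
  then show ?thesis
    unfolding sum_permutes_four
    by (simp add: G_def form3_sort[OF b] shift_simps)
qed

lemma cup_3_1_top:
  assumes a: "is_form 3 a"
  shows "cup 3 1 a b x [D1, D2, D3, D4] =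
      a x [D1, D2, D3] * b (x + shift 1 1 1 0) [D4] - a x [D1, D2, D4] * b (x + shift 1 1 0 1) [D3]
       + a x [D1, D3, D4] * b (x + shift 1 0 1 1) [D2] - a x [D2, D3, D4] * b (x + shift 0 1 1 1) [D1]"
proof -
  let ?m = "[D1, D2, D3, D4]"
  define G where "G s i j k l = real_of_int s / 6 * a x [?m ! i, ?m ! j, ?m ! k]
     * b (x + unit_vec (?m ! i) + unit_vec (?m ! j) + unit_vec (?m ! k)) [?m ! l]" for s i j k l
  have "cup 3 1 a b x ?m = (\<Sum>\<sigma> | \<sigma> permutes {..<4}. G (sign \<sigma>) (\<sigma> 0) (\<sigma> 1) (\<sigma> 2) (\<sigma> 3))"
    unfolding cup_def G_def
    by (simp add: upt_rec numeral_2_eq_2[symmetric] numeral_3_eq_3[symmetric]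
        lessThan_nat_numeral lessThan_Suc add_ac fact_numeral)
  then show ?thesis
    unfolding sum_permutes_four
    by (simp add: G_def form3_sort[OF a] shift_simps)
qed

text \<open>Both orders of the indices of \<open>b\<close> are kept, because in \<open>cup1\<close>
  the factors are reflected contractions; these are unfolded first and antisymmetry is applied to
  the original form afterwards.\<close>

lemma cup_1_2:
  "cup 1 2 a b x [i, j, k] =
     (a x [i] * (b (x + unit_vec i) [j, k] - b (x + unit_vec i) [k, j])
    - a x [j] * (b (x + unit_vec j) [i, k] - b (x + unit_vec j) [k, i])
    + a x [k] * (b (x + unit_vec k) [i, j] - b (x + unit_vec k) [j, i])) / 2"
proof -
  let ?m = "[i, j, k]"
  define G where "G s p q r = real_of_int s / 2 * a x [?m ! p]
     * b (x + unit_vec (?m ! p)) [?m ! q, ?m ! r]" for s p q r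
  have "cup 1 2 a b x ?m = (\<Sum>\<sigma> | \<sigma> permutes {..<3}. G (sign \<sigma>) (\<sigma> 0) (\<sigma> 1) (\<sigma> 2))"
    unfolding cup_def G_def
    by (simp add: upt_rec numeral_2_eq_2[symmetric] numeral_3_eq_3[symmetric]
        lessThan_nat_numeral lessThan_Suc add_ac fact_numeral)
  then show ?thesis
    unfolding sum_permutes_three
    by (simp add: G_def field_simps)
qed

lemma reflect_site_reflect_site: "reflect_site \<mu> (reflect_site \<mu> x) = x"
  by (simp add: reflect_site_def vec_eq_iff)

lemma of_int_mod_ring_minus:
  "of_int_mod_ring (- a) = - (of_int_mod_ring a :: 'n::finite mod_ring)"
  using of_int_mod_ring_add[of a "- a", where ?'n='n]
  by (simp add: of_int_mod_ring_zero eq_neg_iff_add_eq_0 neg_eq_iff_add_eq_0 add.commute)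

lemma reflect_site_shift:
  "reflect_site D1 (x + shift p q r s) = reflect_site D1 x + shift (- p) (- q) (- r) (- s)"
  "reflect_site D2 (x + shift p q r s) = reflect_site D2 x + shift p (- q) (- r) (- s)"
  "reflect_site D3 (x + shift p q r s) = reflect_site D3 x + shift p q (- r) (- s)"
  "reflect_site D4 (x + shift p q r s) = reflect_site D4 x + shift p q r (- s)"
  by (auto simp: reflect_site_def shift_def vec_eq_iff of_int_mod_ring_minus split: dir.split)

text \<open>Each of the four contracted directions contributes the three terms of
  \<open>cup_1_2\<close>. The outer reflection undoes the inner one on sites, so that only
  translations remain, caused by the moved base points in \<open>reflect_form\<close>.\<close>

lemma cup1_2_3_top:
  assumes a: "is_form 2 a" and b: "is_form 3 b"
  shows "cup1 2 3 a b x [D1, D2, D3, D4] =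
      a (x + shift 0 0 1 1) [D1, D2] * b x [D1, D3, D4] - a (x + shift 0 1 0 1) [D1, D3] * b x [D1, D2, D4]
       + a (x + shift 0 1 1 0) [D1, D4] * b x [D1, D2, D3] + a (x + shift 0 0 1 1) [D1, D2] * b (x + shift 1 0 0 0) [D2, D3, D4]
       - a (x + shift 0 0 0 1) [D2, D3] * b x [D1, D2, D4] + a (x + shift 0 0 1 0) [D2, D4] * b x [D1, D2, D3]
       + a (x + shift 0 0 0 1) [D1, D3] * b (x + shift 1 0 0 0) [D2, D3, D4] - a (x + shift 0 0 0 1) [D2, D3] * b (x + shift 0 1 0 0) [D1, D3, D4]
       + a x [D3, D4] * b x [D1, D2, D3] + a x [D1, D4] * b (x + shift 1 0 0 0) [D2, D3, D4]
       - a x [D2, D4] * b (x + shift 0 1 0 0) [D1, D3, D4] + a x [D3, D4] * b (x + shift 0 0 1 0) [D1, D2, D4]"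
  by (simp add: cup1_def omit_def lessThan_nat_numeral lessThan_Suc Let_def reflect_form_def contract_def
      cup_1_2[unfolded One_nat_def] form2_sort[OF a] form3_sort[OF b] shift_simps shift_zero reflect_site_shift
      reflect_site_reflect_site field_simps)

lemma lattice_sum_cup1_2_3:
  assumes a: "is_form 2 a" and b: "is_form 3 b"
  shows "lattice_sum (cup1 2 3 a b) =
      corr a [D1, D2] b [D1, D3, D4] 0 0 (-1) (-1) - corr a [D1, D3] b [D1, D2, D4] 0 (-1) 0 (-1)
       + corr a [D1, D4] b [D1, D2, D3] 0 (-1) (-1) 0 + corr a [D1, D2] b [D2, D3, D4] 1 0 (-1) (-1)
       - corr a [D2, D3] b [D1, D2, D4] 0 0 0 (-1) + corr a [D2, D4] b [D1, D2, D3] 0 0 (-1) 0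
       + corr a [D1, D3] b [D2, D3, D4] 1 0 0 (-1) - corr a [D2, D3] b [D1, D3, D4] 0 1 0 (-1)
       + corr a [D3, D4] b [D1, D2, D3] 0 0 0 0 + corr a [D1, D4] b [D2, D3, D4] 1 0 0 0
       - corr a [D2, D4] b [D1, D3, D4] 0 1 0 0 + corr a [D3, D4] b [D1, D2, D4] 0 0 1 0"
  by (simp add: lattice_sum_def cup1_2_3_top[OF assms] sum.distrib sum_subtractf sum_negf corr_sum)

lemma lattice_sum_cup_1_3:
  assumes b: "is_form 3 b"
  shows "lattice_sum (cup 1 3 a b) =
      corr a [D1] b [D2, D3, D4] 1 0 0 0 - corr a [D2] b [D1, D3, D4] 0 1 0 0
       + corr a [D3] b [D1, D2, D4] 0 0 1 0 - corr a [D4] b [D1, D2, D3] 0 0 0 1"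
  by (simp add: lattice_sum_def cup_1_3_top[OF assms] sum.distrib sum_subtractf sum_negf corr_sum
      del: One_nat_def)

lemma lattice_sum_cup_2_2:
  assumes a: "is_form 2 a" and b: "is_form 2 b"
  shows "lattice_sum (cup 2 2 a b) =
      corr a [D1, D2] b [D3, D4] 1 1 0 0 - corr a [D1, D3] b [D2, D4] 1 0 1 0
       + corr a [D1, D4] b [D2, D3] 1 0 0 1 + corr a [D2, D3] b [D1, D4] 0 1 1 0
       - corr a [D2, D4] b [D1, D3] 0 1 0 1 + corr a [D3, D4] b [D1, D2] 0 0 1 1"
  by (simp add: lattice_sum_def cup_2_2_top[OF assms] sum.distrib sum_subtractf sum_negf corr_sum
      del: One_nat_def)

lemma lattice_sum_cup_3_1:
  assumes a: "is_form 3 a"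
  shows "lattice_sum (cup 3 1 a b) =
      corr a [D1, D2, D3] b [D4] 1 1 1 0 - corr a [D1, D2, D4] b [D3] 1 1 0 1
       + corr a [D1, D3, D4] b [D2] 1 0 1 1 - corr a [D2, D3, D4] b [D1] 0 1 1 1"
  by (simp add: lattice_sum_def cup_3_1_top[OF assms] sum.distrib sum_subtractf sum_negf corr_sum
      del: One_nat_def)

section \<open>Summation by parts and linearity\<close>

lemma ext_d_2:
  "ext_d a x [i, j] = (a (x + unit_vec i) [j] - a x [j]) - (a (x + unit_vec j) [i] - a x [i])"
  by (simp add: ext_d_def omit_def lessThan_Suc)

lemma ext_d_3:
  "ext_d a x [i, j, k] = (a (x + unit_vec i) [j, k] - a x [j, k]) - (a (x + unit_vec j) [i, k] - a x [i, k])
     + (a (x + unit_vec k) [i, j] - a x [i, j])"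
  by (simp add: ext_d_def omit_def lessThan_Suc)

lemma corr_ext_d_right_2:
  "corr a K (ext_d b) [D1, D2] p q r s =
      (corr a K b [D2] (p + 1) q r s - corr a K b [D2] p q r s) - (corr a K b [D1] p (q + 1) r s - corr a K b [D1] p q r s)"
  "corr a K (ext_d b) [D1, D3] p q r s =
      (corr a K b [D3] (p + 1) q r s - corr a K b [D3] p q r s) - (corr a K b [D1] p q (r + 1) s - corr a K b [D1] p q r s)"
  "corr a K (ext_d b) [D1, D4] p q r s =
      (corr a K b [D4] (p + 1) q r s - corr a K b [D4] p q r s) - (corr a K b [D1] p q r (s + 1) - corr a K b [D1] p q r s)"
  "corr a K (ext_d b) [D2, D3] p q r s =
      (corr a K b [D3] p (q + 1) r s - corr a K b [D3] p q r s) - (corr a K b [D2] p q (r + 1) s - corr a K b [D2] p q r s)"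
  "corr a K (ext_d b) [D2, D4] p q r s =
      (corr a K b [D4] p (q + 1) r s - corr a K b [D4] p q r s) - (corr a K b [D2] p q r (s + 1) - corr a K b [D2] p q r s)"
  "corr a K (ext_d b) [D3, D4] p q r s =
      (corr a K b [D4] p q (r + 1) s - corr a K b [D4] p q r s) - (corr a K b [D3] p q r (s + 1) - corr a K b [D3] p q r s)"
  by (simp_all add: corr_def ext_d_2 shift_simps algebra_simps sum.distrib sum_subtractf)

text \<open>A forward step of the left factor is transferred to the right one by a translation,
  hence the decreasing offsets. On a torus there are no boundary terms.\<close>

lemma corr_ext_d_left_2:
  "corr (ext_d a) [D1, D2] b K p q r s =
      (corr a [D2] b K (p - 1) q r s - corr a [D2] b K p q r s) - (corr a [D1] b K p (q - 1) r s - corr a [D1] b K p q r s)"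
  "corr (ext_d a) [D1, D3] b K p q r s =
      (corr a [D3] b K (p - 1) q r s - corr a [D3] b K p q r s) - (corr a [D1] b K p q (r - 1) s - corr a [D1] b K p q r s)"
  "corr (ext_d a) [D1, D4] b K p q r s =
      (corr a [D4] b K (p - 1) q r s - corr a [D4] b K p q r s) - (corr a [D1] b K p q r (s - 1) - corr a [D1] b K p q r s)"
  "corr (ext_d a) [D2, D3] b K p q r s =
      (corr a [D3] b K p (q - 1) r s - corr a [D3] b K p q r s) - (corr a [D2] b K p q (r - 1) s - corr a [D2] b K p q r s)"
  "corr (ext_d a) [D2, D4] b K p q r s =
      (corr a [D4] b K p (q - 1) r s - corr a [D4] b K p q r s) - (corr a [D2] b K p q r (s - 1) - corr a [D2] b K p q r s)"
  "corr (ext_d a) [D3, D4] b K p q r s =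
      (corr a [D4] b K p q (r - 1) s - corr a [D4] b K p q r s) - (corr a [D3] b K p q r (s - 1) - corr a [D3] b K p q r s)"
  by (simp_all add: corr_def[of "ext_d a"] ext_d_2 shift_simps left_diff_distrib distrib_right sum.distrib sum_subtractf corr_sum)

lemma corr_ext_d_right_3:
  "corr a K (ext_d b) [D1, D2, D3] p q r s =
      (corr a K b [D2, D3] (p + 1) q r s - corr a K b [D2, D3] p q r s) - (corr a K b [D1, D3] p (q + 1) r s - corr a K b [D1, D3] p q r s)
       + (corr a K b [D1, D2] p q (r + 1) s - corr a K b [D1, D2] p q r s)"
  "corr a K (ext_d b) [D1, D2, D4] p q r s =
      (corr a K b [D2, D4] (p + 1) q r s - corr a K b [D2, D4] p q r s) - (corr a K b [D1, D4] p (q + 1) r s - corr a K b [D1, D4] p q r s)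
       + (corr a K b [D1, D2] p q r (s + 1) - corr a K b [D1, D2] p q r s)"
  "corr a K (ext_d b) [D1, D3, D4] p q r s =
      (corr a K b [D3, D4] (p + 1) q r s - corr a K b [D3, D4] p q r s) - (corr a K b [D1, D4] p q (r + 1) s - corr a K b [D1, D4] p q r s)
       + (corr a K b [D1, D3] p q r (s + 1) - corr a K b [D1, D3] p q r s)"
  "corr a K (ext_d b) [D2, D3, D4] p q r s =
      (corr a K b [D3, D4] p (q + 1) r s - corr a K b [D3, D4] p q r s) - (corr a K b [D2, D4] p q (r + 1) s - corr a K b [D2, D4] p q r s)
       + (corr a K b [D2, D3] p q r (s + 1) - corr a K b [D2, D3] p q r s)"
  by (simp_all add: corr_def ext_d_3 shift_simps algebra_simps sum.distrib sum_subtractf)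

lemma corr_ext_d_left_3:
  "corr (ext_d a) [D1, D2, D3] b K p q r s =
      (corr a [D2, D3] b K (p - 1) q r s - corr a [D2, D3] b K p q r s) - (corr a [D1, D3] b K p (q - 1) r s - corr a [D1, D3] b K p q r s)
       + (corr a [D1, D2] b K p q (r - 1) s - corr a [D1, D2] b K p q r s)"
  "corr (ext_d a) [D1, D2, D4] b K p q r s =
      (corr a [D2, D4] b K (p - 1) q r s - corr a [D2, D4] b K p q r s) - (corr a [D1, D4] b K p (q - 1) r s - corr a [D1, D4] b K p q r s)
       + (corr a [D1, D2] b K p q r (s - 1) - corr a [D1, D2] b K p q r s)"
  "corr (ext_d a) [D1, D3, D4] b K p q r s =
      (corr a [D3, D4] b K (p - 1) q r s - corr a [D3, D4] b K p q r s) - (corr a [D1, D4] b K p q (r - 1) s - corr a [D1, D4] b K p q r s)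
       + (corr a [D1, D3] b K p q r (s - 1) - corr a [D1, D3] b K p q r s)"
  "corr (ext_d a) [D2, D3, D4] b K p q r s =
      (corr a [D3, D4] b K p (q - 1) r s - corr a [D3, D4] b K p q r s) - (corr a [D2, D4] b K p q (r - 1) s - corr a [D2, D4] b K p q r s)
       + (corr a [D2, D3] b K p q r (s - 1) - corr a [D2, D3] b K p q r s)"
  by (simp_all add: corr_def[of "ext_d a"] ext_d_3 shift_simps left_diff_distrib distrib_right sum.distrib sum_subtractf corr_sum)

text \<open>The Leibniz rule for \<open>cup1\<close>: the last twelve terms make up the lattice sum of \<open>cup1 3 2 (ext_d a) b\<close>.\<close>

lemma lattice_sum_cup1_ext_d:
  assumes a: "is_form 2 a" and b: "is_form 2 b" and db: "is_form 3 (ext_d b)"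
  shows "lattice_sum (cup1 2 3 a (ext_d b)) = lattice_sum (cup 2 2 a b) - lattice_sum (cup 2 2 b a) +
      corr (ext_d a) [D1, D3, D4] b [D1, D2] 0 (-1) 0 0 - corr (ext_d a) [D1, D2, D4] b [D1, D3] 0 0 (-1) 0
       + corr (ext_d a) [D1, D2, D3] b [D1, D4] 0 0 0 (-1) + corr (ext_d a) [D2, D3, D4] b [D1, D2] 0 0 0 0
       - corr (ext_d a) [D1, D2, D4] b [D2, D3] 1 0 (-1) 0 + corr (ext_d a) [D1, D2, D3] b [D2, D4] 1 0 0 (-1)
       + corr (ext_d a) [D2, D3, D4] b [D1, D3] 0 1 0 0 - corr (ext_d a) [D1, D3, D4] b [D2, D3] 1 0 0 0
       + corr (ext_d a) [D1, D2, D3] b [D3, D4] 1 1 0 (-1) + corr (ext_d a) [D2, D3, D4] b [D1, D4] 0 1 1 0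
       - corr (ext_d a) [D1, D3, D4] b [D2, D4] 1 0 1 0 + corr (ext_d a) [D1, D2, D4] b [D3, D4] 1 1 0 0"
  by (simp add: lattice_sum_cup1_2_3[OF a db] lattice_sum_cup_2_2[OF a b] lattice_sum_cup_2_2[OF b a]
      corr_commute[where a=b and b=a] corr_ext_d_right_3 corr_ext_d_left_3)

text \<open>One shape covers all combinations that occur: \<open>k\<close> is 2\<pi> in the field
  strength, plus or minus the magnetic charge when \<open>n\<close> is split, and 1 or -1 in the
  gauge fixing. Hence the factors \<open>1 *\<close> in \<open>axial_gauge\<close>.\<close>

lemma corr_linear_left:
  "corr (\<lambda>x \<mu>s. a x \<mu>s + k * a' x \<mu>s) I b J p q r s = corr a I b J p q r s + k * corr a' I b J p q r s"
  by (simp add: corr_def algebra_simps sum.distrib sum_distrib_left)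

lemma corr_linear_right:
  "corr a I (\<lambda>x \<mu>s. b x \<mu>s + k * b' x \<mu>s) J p q r s = corr a I b J p q r s + k * corr a I b' J p q r s"
  by (simp add: corr_def algebra_simps sum.distrib sum_distrib_left)

lemma corr_zero: "corr (\<lambda>_ _. 0) I b J p q r s = 0" "corr a I (\<lambda>_ _. 0) J p q r s = 0"
  by (simp_all add: corr_def)

lemma is_form_linear:
  assumes "is_form r a" "is_form r b"
  shows "is_form r (\<lambda>x \<mu>s. a x \<mu>s + k * b x \<mu>s)"
  using assms by (auto simp: is_form_def)

lemma ext_d_linear:
  "ext_d (\<lambda>x \<mu>s. a x \<mu>s + k * b x \<mu>s) = (\<lambda>x \<mu>s. ext_d a x \<mu>s + k * ext_d b x \<mu>s)"
  by (simp add: ext_d_def fun_eq_iff algebra_simps sum.distrib sum_subtractf sum_distrib_left)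

lemma is_formI1:
  assumes "\<And>x \<mu>s. length \<mu>s \<noteq> 1 \<Longrightarrow> a x \<mu>s = 0"
  shows "is_form 1 a"
proof -
  have "\<not> (i < j \<and> j < length \<mu>s)" if "length \<mu>s = 1" for i j :: nat and \<mu>s :: "dir list"
    using that by simp
  with assms show ?thesis
    unfolding is_form_def by (metis add.inverse_neutral length_list_update)
qed

lemma is_formI2:
  assumes "\<And>x \<mu>s. length \<mu>s \<noteq> 2 \<Longrightarrow> a x \<mu>s = 0" and swap: "\<And>x i j. a x [j, i] = - a x [i, j]"
  shows "is_form 2 a"
  unfolding is_form_def
proof (intro conjI allI impI)
  fix x and \<mu>s :: "dir list" and i j :: nat
  assume ij: "i < j \<and> j < length \<mu>s"
  show "a x (\<mu>s[i := \<mu>s ! j, j := \<mu>s ! i]) = - a x \<mu>s"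
  proof (cases "length \<mu>s = 2")
    case True
    then obtain k l where m: "\<mu>s = [k, l]" by (auto simp: numeral_2_eq_2 length_Suc_conv)
    moreover have "i = 0" "j = 1" using ij True by auto
    ultimately show ?thesis using swap[of x l k] by simp
  qed (simp add: assms(1))
qed (rule assms(1))

lemma is_formI3:
  assumes "\<And>x \<mu>s. length \<mu>s \<noteq> 3 \<Longrightarrow> a x \<mu>s = 0"
    and swap: "\<And>x i j k. a x [j, i, k] = - a x [i, j, k]" "\<And>x i j k. a x [i, k, j] = - a x [i, j, k]"
  shows "is_form 3 a"
  unfolding is_form_def
proof (intro conjI allI impI)
  fix x and \<mu>s :: "dir list" and i j :: nat
  assume ij: "i < j \<and> j < length \<mu>s"
  show "a x (\<mu>s[i := \<mu>s ! j, j := \<mu>s ! i]) = - a x \<mu>s"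
  proof (cases "length \<mu>s = 3")
    case True
    then obtain k l m where m: "\<mu>s = [k, l, m]" by (auto simp: numeral_3_eq_3 length_Suc_conv)
    \<comment> \<open>Exchanging the outer indices is a product of three adjacent swaps.\<close>
    have "a x [m, l, k] = - a x [k, l, m]"
      using swap(1)[of x m l k] swap(2)[of x l m k] swap(1)[of x l k m] by simp
    moreover have "i = 0 \<and> j = 1 \<or> i = 0 \<and> j = 2 \<or> i = 1 \<and> j = 2" using ij True by auto
    ultimately show ?thesis
      using swap(1)[of x l k m] swap(2)[of x k m l] by (auto simp: m numeral_2_eq_2)
  qed (simp add: assms(1))
qed (rule assms(1))

lemma is_form_length: "is_form r a \<Longrightarrow> length \<mu>s \<noteq> r \<Longrightarrow> a x \<mu>s = 0"
  by (simp add: is_form_def)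

lemma ext_d_length:
  assumes "is_form r a" "length \<mu>s \<noteq> Suc r"
  shows "ext_d a x \<mu>s = 0"
  unfolding ext_d_def
proof (intro sum.neutral ballI)
  fix j assume "j \<in> {..<length \<mu>s}"
  then have "length (omit j \<mu>s) = length \<mu>s - 1" by (simp add: omit_def)
  then have "length (omit j \<mu>s) \<noteq> r" using assms(2) \<open>j \<in> _\<close> by auto
  then show "(-1) ^ j * (a (x + unit_vec (\<mu>s ! j)) (omit j \<mu>s) - a x (omit j \<mu>s)) = 0"
    by (simp add: is_form_length[OF assms(1)])
qed

lemma is_form_ext_d_1: "is_form 1 a \<Longrightarrow> is_form 2 (ext_d a)"
  by (rule is_formI2) (auto simp: ext_d_2 ext_d_length)

lemma is_form_ext_d_2:
  assumes "is_form 2 a"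
  shows "is_form 3 (ext_d a)"
proof (rule is_formI3)
  show "ext_d a x [j, i, k] = - ext_d a x [i, j, k]" for x i j k
    using form2_swap[OF assms, of _ i j] by (simp add: ext_d_3)
  show "ext_d a x [i, k, j] = - ext_d a x [i, j, k]" for x i j k
    using form2_swap[OF assms, of _ k j] by (simp add: ext_d_3)
qed (use assms in \<open>auto simp: ext_d_length\<close>)

lemma form3_eq_zeroI:
  assumes a: "is_form 3 a"
    and z: "\<And>x. a x [D1, D2, D3] = 0" "\<And>x. a x [D1, D2, D4] = 0" "\<And>x. a x [D1, D3, D4] = 0"
      "\<And>x. a x [D2, D3, D4] = 0"
  shows "a = (\<lambda>_ _. 0)"
proof (intro ext)
  fix x \<mu>s
  have rep: "a x [i, i, j] = 0" "a x [j, i, i] = 0" for i j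
    using form3_swap(1)[OF a, of x i i j] form3_swap(2)[OF a, of x j i i] by auto
  have "a x [i, j, k] = 0" for i j k
    by (cases i; cases j; cases k) (simp_all add: rep z form3_sort[OF a])
  then show "a x \<mu>s = 0"
    using is_form_length[OF a, of \<mu>s x] by (cases "length \<mu>s = 3") (auto simp: numeral_3_eq_3 length_Suc_conv)
qed

lemma ext_d_ext_d:
  assumes "is_form 1 a"
  shows "ext_d (ext_d a) = (\<lambda>_ _. 0)"
  by (rule form3_eq_zeroI)
    (use is_form_ext_d_2[OF is_form_ext_d_1[OF assms]] in \<open>auto simp: ext_d_3 ext_d_2 add_ac\<close>)

text \<open>Stokes on the torus: the sum of \<open>d(a \<union> b)\<close> vanishes, and the Leibniz
  rule has a minus sign in front of \<open>a \<union> db\<close> because \<open>a\<close> has degree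
  1. In the mirrored rule below the left factor has degree 2, which explains the sign there.\<close>

lemma lattice_sum_cup_ext_d_left:
  assumes a: "is_form 1 a" and b: "is_form 2 b"
  shows "lattice_sum (cup 2 2 (ext_d a) b) = lattice_sum (cup 1 3 a (ext_d b))"
  by (simp add: lattice_sum_cup_2_2[OF is_form_ext_d_1[OF a] b] lattice_sum_cup_1_3[OF is_form_ext_d_2[OF b]]
      corr_ext_d_right_3 corr_ext_d_left_2 del: One_nat_def)

lemma lattice_sum_cup_ext_d_right:
  assumes a: "is_form 1 a" and b: "is_form 2 b"
  shows "lattice_sum (cup 2 2 b (ext_d a)) = - lattice_sum (cup 3 1 (ext_d b) a)"
  by (simp add: lattice_sum_cup_2_2[OF b is_form_ext_d_1[OF a]] lattice_sum_cup_3_1[OF is_form_ext_d_2[OF b]]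
      corr_ext_d_right_2 corr_ext_d_left_3 del: One_nat_def)

text \<open>\<open>cup1\<close> measures how far the cup product of 2-forms is from being
  commutative. For closed \<open>a\<close> the twelve remaining terms of the Leibniz rule drop out,
  while \<open>b\<close> may be a form such as \<open>n\<close> or \<open>l\<close> that is not
  closed.\<close>

lemma lattice_sum_cup1_closed:
  assumes a: "is_form 2 a" and b: "is_form 2 b" and "ext_d a = (\<lambda>_ _. 0)"
  shows "lattice_sum (cup1 2 3 a (ext_d b)) = lattice_sum (cup 2 2 a b) - lattice_sum (cup 2 2 b a)"
  by (simp add: lattice_sum_cup1_ext_d[OF a b is_form_ext_d_2[OF b]] assms(3) corr_zero)

lemma lattice_sum_cup_linear_left:
  assumes "is_form 2 a" "is_form 2 a'" "is_form 2 b"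
  shows "lattice_sum (cup 2 2 (\<lambda>x \<mu>s. a x \<mu>s + k * a' x \<mu>s) b)
    = lattice_sum (cup 2 2 a b) + k * lattice_sum (cup 2 2 a' b)"
  by (simp add: lattice_sum_cup_2_2 is_form_linear assms corr_linear_left algebra_simps)

lemma lattice_sum_cup_linear_right:
  assumes "is_form 2 a" "is_form 2 b" "is_form 2 b'"
  shows "lattice_sum (cup 2 2 a (\<lambda>x \<mu>s. b x \<mu>s + k * b' x \<mu>s))
    = lattice_sum (cup 2 2 a b) + k * lattice_sum (cup 2 2 a b')"
  by (simp add: lattice_sum_cup_2_2 is_form_linear assms corr_linear_right algebra_simps)

lemma lattice_sum_cup1_linear_left:
  assumes "is_form 2 a" "is_form 2 a'" "is_form 3 b"
  shows "lattice_sum (cup1 2 3 (\<lambda>x \<mu>s. a x \<mu>s + k * a' x \<mu>s) b)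
    = lattice_sum (cup1 2 3 a b) + k * lattice_sum (cup1 2 3 a' b)"
  by (simp add: lattice_sum_cup1_2_3 is_form_linear assms corr_linear_left algebra_simps)

lemma lattice_sum_cup1_linear_right:
  assumes "is_form 2 a" "is_form 3 b" "is_form 3 b'"
  shows "lattice_sum (cup1 2 3 a (\<lambda>x \<mu>s. b x \<mu>s + k * b' x \<mu>s))
    = lattice_sum (cup1 2 3 a b) + k * lattice_sum (cup1 2 3 a b')"
  by (simp add: lattice_sum_cup1_2_3 is_form_linear assms corr_linear_right algebra_simps)

lemma corr_in_Ints:
  assumes "\<And>x. a x I \<in> \<int>" "\<And>x. b x J \<in> \<int>"
  shows "corr a I b J p q r s \<in> \<int>"
  unfolding corr_def by (intro Ints_sum Ints_mult assms)

lemma lattice_sum_cup_in_Ints: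
  assumes "a \<in> int_forms 2" "b \<in> int_forms 2"
  shows "lattice_sum (cup 2 2 a b) \<in> \<int>"
  using assms by (auto simp: int_forms_def lattice_sum_cup_2_2 intro!: Ints_add Ints_diff corr_in_Ints)

lemma lattice_sum_cup1_in_Ints:
  assumes "a \<in> int_forms 2" "b \<in> int_forms 3"
  shows "lattice_sum (cup1 2 3 a b) \<in> \<int>"
  using assms by (auto simp: int_forms_def lattice_sum_cup1_2_3 intro!: Ints_add Ints_diff corr_in_Ints)

lemma ext_d_in_int_forms:
  assumes "a \<in> int_forms 2"
  shows "ext_d a \<in> int_forms 3"
  using assms by (auto simp: int_forms_def is_form_ext_d_2 ext_d_def intro!: Ints_sum Ints_mult Ints_diff Ints_power)

section \<open>Parity of the Pontryagin square\<close>

lemma is_form_zero: "is_form r (\<lambda>_ _. 0)"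
  by (simp add: is_form_def)

definition closed_form :: "'n::finite form \<Rightarrow> bool" where
  "closed_form a \<longleftrightarrow> is_form 2 a \<and> ext_d a = (\<lambda>_ _. 0)"

abbreviation height :: "'n::finite site \<Rightarrow> nat" where
  "height x \<equiv> nat (to_int_mod_ring (x $ D1))"

lemma shift_D1_component: "shift p q r s $ D1 = of_int_mod_ring p"
  by (simp add: shift_def)

lemma height_less: "height (x :: 'n::finite site) < CARD('n)"
proof -
  have "to_int_mod_ring (x $ D1) \<in> {0..<int CARD('n)}"
    using range_to_int_mod_ring[where ?'a='n] by blast
  then show ?thesis by auto
qed

lemma height_shift:
  "height (x + shift 1 0 0 0 :: 'n::finite site) = (if height x = CARD('n) - 1 then 0 else Suc (height x))"
proof -
  have "to_int_mod_ring (y + of_int_mod_ring 1) = (to_int_mod_ring y + 1) mod int CARD('n)"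
    for y :: "'n mod_ring"
    by transfer (simp add: mod_simps)
  then have h: "to_int_mod_ring ((x + shift 1 0 0 0) $ D1) = (to_int_mod_ring (x $ D1) + 1) mod int CARD('n)"
    by (simp add: shift_D1_component)
  have "to_int_mod_ring (x $ D1) \<in> {0..<int CARD('n)}"
    using range_to_int_mod_ring[where ?'a='n] by blast
  then show ?thesis
    unfolding h by (cases "to_int_mod_ring (x $ D1) + 1 = int CARD('n)") auto
qed

lemma shift_period: "shift (int CARD('n)) 0 0 0 = (0 :: 'n::finite site)"
proof -
  have "of_int_mod_ring (int CARD('n)) = (0 :: 'n mod_ring)" by transfer simp
  then show ?thesis by (auto simp: shift_def vec_eq_iff of_int_mod_ring_zero split: dir.split)
qed

text \<open>Axial gauge in the direction \<open>D1\<close>: subtracting an exact form moves all components of a closed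
  form along \<open>D1\<close> into the last layer, where they add up to the period of the form along \<open>D1\<close>.\<close>

lemma axial_gauge:
  fixes c :: "'n::finite form"
  assumes c: "c \<in> int_forms 2" and dc: "ext_d c = (\<lambda>_ _. 0)"
  obtains B u w where "B \<in> int_forms 1" "u \<in> int_forms 2" "w \<in> int_forms 2"
    "closed_form u" "closed_form w"
    "c = (\<lambda>x \<mu>s. (u x \<mu>s + 1 * w x \<mu>s) + 1 * ext_d B x \<mu>s)"
    "\<And>x i j. i \<noteq> D1 \<Longrightarrow> j \<noteq> D1 \<Longrightarrow> u x [i, j] = 0" "\<And>x i. w x [D1, i] = 0"
proof -
  have cf: "is_form 2 c" and cint: "c x \<mu>s \<in> \<int>" for x \<mu>s
    using c by (auto simp: int_forms_def)
  have c0: "c x [i, i] = 0" for x i using form2_swap[OF cf, of x i i] by simp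
  \<comment> \<open>Line integral of \<open>c\<close> along \<open>D1\<close> from layer 0 up to the
    layer below \<open>x\<close>. It restarts at layer 0, so its difference along \<open>D1\<close>
    reproduces \<open>c\<close> except on the last layer.\<close>
  define B :: "'n form" where "B x \<mu>s = (if length \<mu>s = 1
      then \<Sum>m<height x. c (x + shift (- int (Suc m)) 0 0 0) (D1 # \<mu>s) else 0)" for x \<mu>s
  \<comment> \<open>The period: the integral once around the circle.\<close>
  define S where "S x j = (\<Sum>m<CARD('n). c (x + shift (- int m) 0 0 0) [D1, j])" for x j
  \<comment> \<open>The periods are concentrated on the last layer. The two conditional terms
    antisymmetrise and cancel for \<open>[D1, D1]\<close>.\<close>
  define u :: "'n form" where "u x \<mu>s = (if length \<mu>s = 2 \<and> height x = CARD('n) - 1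
      then (if \<mu>s ! 0 = D1 then S x (\<mu>s ! 1) else 0) - (if \<mu>s ! 1 = D1 then S x (\<mu>s ! 0) else 0) else 0)"
    for x \<mu>s
  define w :: "'n form" where "w x \<mu>s = (c x \<mu>s + (-1) * u x \<mu>s) + (-1) * ext_d B x \<mu>s" for x \<mu>s
  have B: "B \<in> int_forms 1"
    unfolding int_forms_def by (auto simp: B_def intro!: is_formI1[unfolded One_nat_def] Ints_sum cint)
  then have Bf: "is_form 1 B" by (simp add: int_forms_def)
  have dBf: "is_form 2 (ext_d B)" by (rule is_form_ext_d_1[OF Bf])
  have uf: "is_form 2 u"
    by (rule is_formI2) (auto simp: u_def)
  have Sint: "S x j \<in> \<int>" for x j unfolding S_def by (intro Ints_sum cint)
  have u: "u \<in> int_forms 2"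
    using uf Sint by (auto simp: int_forms_def u_def)
  have dBint: "ext_d B x \<mu>s \<in> \<int>" for x \<mu>s
    using B by (auto simp: int_forms_def ext_d_def intro!: Ints_sum Ints_mult Ints_power Ints_diff)
  have wf: "is_form 2 w"
    unfolding w_def by (intro is_form_linear cf uf dBf)
  have w: "w \<in> int_forms 2"
    using wf u dBint cint by (auto simp: int_forms_def w_def intro!: Ints_add Ints_diff)
  have S0: "S x D1 = 0" for x by (simp add: S_def c0)
  have B0: "B x [D1] = 0" for x by (simp add: B_def c0)
  have w1: "w x [D1, j] = 0" for x j
  proof -
    have "ext_d B x [D1, j] = B (x + shift 1 0 0 0) [j] - B x [j]"
      by (simp add: ext_d_2 B0 unit_vec_shift)
    moreover have "u x [D1, j] = (if height x = CARD('n) - 1 then S x j else 0)"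
      by (simp add: u_def S0)
    moreover have "c x [D1, j] - (B (x + shift 1 0 0 0) [j] - B x [j]) =
        (if height x = CARD('n) - 1 then S x j else 0)"
    proof (cases "height x = CARD('n) - 1")
      case True
      have "CARD('n) = Suc (height x)" using True height_less[of x] by simp
      then have "S x j = c x [D1, j] + B x [j]"
        by (simp add: S_def B_def sum.lessThan_Suc_shift shift_zero del: sum.lessThan_Suc)
      \<comment> \<open>The next layer is layer 0, where \<open>B\<close> is an empty sum.\<close>
      moreover have "B (x + shift 1 0 0 0) [j] = 0"
        using height_shift[of x] True by (simp add: B_def)
      ultimately show ?thesis using True by simp
    next
      case False
      have "B (x + shift 1 0 0 0) [j] = (\<Sum>m<Suc (height x). c (x + shift (- int m) 0 0 0) [D1, j])"
        using height_shift[of x] False by (simp add: B_def shift_simps del: sum.lessThan_Suc)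
      also have "\<dots> = c x [D1, j] + B x [j]"
        by (simp add: B_def sum.lessThan_Suc_shift shift_zero del: sum.lessThan_Suc)
      finally show ?thesis using False by simp
    qed
    ultimately show ?thesis by (simp add: w_def)
  qed
  \<comment> \<open>Periods of a closed form are closed along the layers: closedness with index
    \<open>D1\<close> makes the curl of \<open>S\<close> a telescoping sum around the circle, which
    ends where it began.\<close>
  have S_closed: "S (x + unit_vec j) k - S x k = S (x + unit_vec k) j - S x j" for x j k
  proof -
    define f where "f m = c (x + shift (1 - int m) 0 0 0) [j, k]" for m
    have "ext_d c y [D1, j, k] = 0" for y using dc by simp
    then have "(c (y + unit_vec j) [D1, k] - c y [D1, k]) - (c (y + unit_vec k) [D1, j] - c y [D1, j])
        = c (y + unit_vec D1) [j, k] - c y [j, k]" for y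
      by (simp add: ext_d_3 algebra_simps)
    from this[of "x + shift (- int m) 0 0 0" for m]
    have "(S (x + unit_vec j) k - S x k) - (S (x + unit_vec k) j - S x j) = (\<Sum>m<CARD('n). f m - f (Suc m))"
      by (simp add: S_def f_def shift_simps sum_subtractf[symmetric] add_ac)
    also have "\<dots> = f 0 - f CARD('n)"
      by (rule sum_lessThan_telescope')
    also have "f CARD('n) = f 0"
    proof -
      have "(shift 1 0 0 0 :: 'n site) = shift (1 - int CARD('n)) 0 0 0 + shift (int CARD('n)) 0 0 0"
        by (simp add: shift_add)
      then show ?thesis by (simp add: f_def shift_period)
    qed
    finally show ?thesis by simp
  qed
  \<comment> \<open>All components of \<open>u\<close> carry the index \<open>D1\<close>, so only
    transverse differences survive; they stay in the layer and cancel by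
    \<open>S_closed\<close>.\<close>
  have du: "ext_d u = (\<lambda>_ _. 0)"
  proof (rule form3_eq_zeroI[OF is_form_ext_d_2[OF uf]])
    note simps = ext_d_3 u_def unit_vec_shift shift_D1_component of_int_mod_ring_zero
    show "ext_d u x [D1, D2, D3] = 0" "ext_d u x [D1, D2, D4] = 0" "ext_d u x [D1, D3, D4] = 0"
      "ext_d u x [D2, D3, D4] = 0" for x
      using S_closed[of x D2 D3] S_closed[of x D2 D4] S_closed[of x D3 D4] by (simp_all add: simps)
  qed
  have dw: "ext_d w = (\<lambda>_ _. 0)"
    unfolding w_def ext_d_linear by (simp add: dc du ext_d_ext_d[OF Bf])
  show ?thesis
  proof (rule that[OF B u w])
    show "closed_form u" "closed_form w" using uf wf du dw by (auto simp: closed_form_def)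
  qed (use w1 in \<open>auto simp: w_def u_def\<close>)
qed

text \<open>After axial gauge fixing \<open>u\<close> and \<open>w\<close> have no self-intersection, and the two cross terms agree.\<close>

lemma even_lattice_sum_cup_closed:
  assumes c: "c \<in> int_forms 2" and dc: "ext_d c = (\<lambda>_ _. 0)"
  obtains k :: int where "lattice_sum (cup 2 2 c c) = 2 * of_int k"
proof -
  obtain B u w where B: "B \<in> int_forms 1" and u: "u \<in> int_forms 2" and w: "w \<in> int_forms 2"
    and du: "closed_form u" and dw: "closed_form w"
    and c_eq: "c = (\<lambda>x \<mu>s. (u x \<mu>s + 1 * w x \<mu>s) + 1 * ext_d B x \<mu>s)"
    and u0: "\<And>x i j. i \<noteq> D1 \<Longrightarrow> j \<noteq> D1 \<Longrightarrow> u x [i, j] = 0" and w0: "\<And>x i. w x [D1, i] = 0"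
    by (rule axial_gauge[OF c dc]) (rule that; assumption)
  have f: "is_form 1 B" "is_form 2 c" "is_form 2 u" "is_form 2 w"
    using B u w c by (simp_all add: int_forms_def)
  have dB: "is_form 2 (ext_d B)" by (rule is_form_ext_d_1[OF f(1)])
  have suw: "is_form 2 (\<lambda>x \<mu>s. u x \<mu>s + 1 * w x \<mu>s)" by (rule is_form_linear[OF f(3,4)])
  note f = f(1) dB f(2-4) suw
  have exact: "lattice_sum (cup 2 2 (ext_d B) a) = 0" "lattice_sum (cup 2 2 a (ext_d B)) = 0"
    if "is_form 2 a" "ext_d a = (\<lambda>_ _. 0)" for a
    using that lattice_sum_cup_ext_d_left[OF f(1) that(1)] lattice_sum_cup_ext_d_right[OF f(1) that(1)]
    by (simp_all add: corr_zero lattice_sum_cup_1_3 lattice_sum_cup_3_1 is_form_zero del: One_nat_def)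
  \<comment> \<open>In every term of the cup product exactly one of the two factors carries the
    index \<open>D1\<close>. For \<open>u\<close> the factor without \<open>D1\<close> vanishes, for
    \<open>w\<close> the factor with it.\<close>
  have uu: "lattice_sum (cup 2 2 u u) = 0"
    by (simp add: lattice_sum_cup_2_2 f corr_def u0)
  have ww: "lattice_sum (cup 2 2 w w) = 0"
    by (simp add: lattice_sum_cup_2_2 f corr_def w0)
  have "lattice_sum (cup1 2 3 u (ext_d w)) = 0"
    using dw lattice_sum_cup1_2_3[OF f(4) is_form_zero] by (simp add: closed_form_def corr_zero)
  then have uw: "lattice_sum (cup 2 2 w u) = lattice_sum (cup 2 2 u w)"
    using lattice_sum_cup1_closed[OF f(4,5)] du by (simp add: closed_form_def)
  \<comment> \<open>The exact part is removed first on the right, against the closed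
    \<open>c\<close>, then on the left, against the closed \<open>u + w\<close>.\<close>
  have "lattice_sum (cup 2 2 c c) = lattice_sum (cup 2 2 c (\<lambda>x \<mu>s. u x \<mu>s + 1 * w x \<mu>s))"
    using lattice_sum_cup_linear_right[OF f(3) f(6) f(2), of 1, folded c_eq] exact(2)[OF f(3) dc]
    by simp
  also have "\<dots> = lattice_sum (cup 2 2 (\<lambda>x \<mu>s. u x \<mu>s + 1 * w x \<mu>s) (\<lambda>x \<mu>s. u x \<mu>s + 1 * w x \<mu>s))"
    using lattice_sum_cup_linear_left[OF f(6) f(2) f(6), of 1, folded c_eq] exact(1)[OF f(6)] du dw
    by (simp add: ext_d_linear[where k=1, simplified] closed_form_def)
  also have "\<dots> = 2 * lattice_sum (cup 2 2 u w)"
    unfolding lattice_sum_cup_linear_left[OF f(4,5,6)]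
      lattice_sum_cup_linear_right[OF f(4,4,5)] lattice_sum_cup_linear_right[OF f(5,4,5)]
    by (simp add: uu ww uw)
  finally show ?thesis
    using lattice_sum_cup_in_Ints[OF u w] that by (auto elim: Ints_cases)
qed

text \<open>Split \<open>n\<close> into \<open>q l\<close> and a closed form \<open>c\<close>. The
  mixed \<open>cup1\<close> term is the difference of \<open>c \<union> l\<close> and
  \<open>l \<union> c\<close>, so together with these two products it gives twice
  \<open>c \<union> l\<close>; and \<open>c \<union> c\<close> is even. Thus the \<open>cup1\<close>
  term is what makes the square well defined modulo 2 under closed shifts.\<close>

lemma pontryagin_mod_two:
  assumes n: "n \<in> int_forms 2" and l: "l \<in> int_forms 2"
    and dn: "ext_d n = (\<lambda>x \<mu>s. of_int q * ext_d l x \<mu>s)"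
  obtains k :: int where "pontryagin n = of_int (q\<^sup>2) * pontryagin l + 2 * of_int k"
proof -
  define c where "c = (\<lambda>x \<mu>s. n x \<mu>s + (- of_int q) * l x \<mu>s)"
  have nf: "is_form 2 n" and lf: "is_form 2 l" and cf: "is_form 2 c"
    using n l is_form_linear[of 2 n l "- of_int q"] by (simp_all add: int_forms_def c_def)
  have c: "c \<in> int_forms 2"
    using n l cf by (auto simp: int_forms_def c_def intro!: Ints_diff Ints_mult)
  have dc: "ext_d c = (\<lambda>_ _. 0)"
    unfolding c_def ext_d_linear by (simp add: dn)
  obtain k where k: "lattice_sum (cup 2 2 c c) = 2 * of_int k"
    using even_lattice_sum_cup_closed[OF c dc] .
  obtain j where j: "lattice_sum (cup 2 2 c l) = of_int j"
    using lattice_sum_cup_in_Ints[OF c l] by (auto elim: Ints_cases)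
  let ?q = "of_int q :: real" and ?C = "\<lambda>a b. lattice_sum (cup 2 2 a b)"
  have n_eq: "n = (\<lambda>x \<mu>s. c x \<mu>s + ?q * l x \<mu>s)" by (simp add: c_def fun_eq_iff)
  have "?C n n = ?C c c + ?q * ?C c l + ?q * (?C l c + ?q * ?C l l)"
    by (subst (1 2) n_eq)
      (simp add: lattice_sum_cup_linear_left lattice_sum_cup_linear_right is_form_linear cf lf)
  moreover have "lattice_sum (cup1 2 3 n (ext_d n))
      = ?q * lattice_sum (cup1 2 3 c (ext_d l)) + ?q\<^sup>2 * lattice_sum (cup1 2 3 l (ext_d l))"
  proof -
    have "lattice_sum (cup1 2 3 n (ext_d n)) = ?q * lattice_sum (cup1 2 3 n (ext_d l))"
      using lattice_sum_cup1_linear_right[OF nf is_form_zero is_form_ext_d_2[OF lf], of ?q]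
        lattice_sum_cup1_2_3[OF nf is_form_zero]
      by (simp add: dn corr_zero)
    also have "lattice_sum (cup1 2 3 n (ext_d l))
        = lattice_sum (cup1 2 3 c (ext_d l)) + ?q * lattice_sum (cup1 2 3 l (ext_d l))"
      by (subst n_eq) (rule lattice_sum_cup1_linear_left[OF cf lf is_form_ext_d_2[OF lf]])
    finally show ?thesis by (simp add: algebra_simps power2_eq_square)
  qed
  moreover have "lattice_sum (cup1 2 3 c (ext_d l)) = ?C c l - ?C l c"
    by (rule lattice_sum_cup1_closed[OF cf lf dc])
  ultimately have "pontryagin n = ?q\<^sup>2 * pontryagin l + 2 * (?q * ?C c l) + ?C c c"
    by (simp add: pontryagin_def algebra_simps power2_eq_square)
  also have "\<dots> = of_int (q\<^sup>2) * pontryagin l + 2 * of_int (q * j + k)"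
    by (simp add: j k algebra_simps)
  finally show ?thesis using that by blast
qed

section \<open>Charges and loops\<close>

lemma increasing_indices_eq:
  "increasing_indices 1 = {[D1], [D2], [D3], [D4]}"
  "increasing_indices 2 = {[D1, D2], [D1, D3], [D1, D4], [D2, D3], [D2, D4], [D3, D4]}"
  "increasing_indices 3 = {[D1, D2, D3], [D1, D2, D4], [D1, D3, D4], [D2, D3, D4]}"
proof -
  have *: "increasing_indices r = set (filter (sorted_wrt (<)) (List.n_lists r [D1, D2, D3, D4]))" for r
  proof -
    have "set [D1, D2, D3, D4] = UNIV" by (simp add: UNIV_dir)
    then show ?thesis by (auto simp: increasing_indices_def set_n_lists)
  qed
  show "increasing_indices 1 = {[D1], [D2], [D3], [D4]}"
    "increasing_indices 2 = {[D1, D2], [D1, D3], [D1, D4], [D2, D3], [D2, D4], [D3, D4]}"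
    "increasing_indices 3 = {[D1, D2, D3], [D1, D2, D4], [D1, D3, D4], [D2, D3, D4]}"
    unfolding * by (simp_all add: numeral_2_eq_2 numeral_3_eq_3 insert_commute)
qed

lemma form_dot_corr:
  "form_dot 1 a b = corr a [D1] b [D1] 0 0 0 0 + corr a [D2] b [D2] 0 0 0 0
     + corr a [D3] b [D3] 0 0 0 0 + corr a [D4] b [D4] 0 0 0 0"
  "form_dot 2 a b = corr a [D1, D2] b [D1, D2] 0 0 0 0 + corr a [D1, D3] b [D1, D3] 0 0 0 0
     + corr a [D1, D4] b [D1, D4] 0 0 0 0 + corr a [D2, D3] b [D2, D3] 0 0 0 0
     + corr a [D2, D4] b [D2, D4] 0 0 0 0 + corr a [D3, D4] b [D3, D4] 0 0 0 0"
  "form_dot 3 a b = corr a [D1, D2, D3] b [D1, D2, D3] 0 0 0 0 + corr a [D1, D2, D4] b [D1, D2, D4] 0 0 0 0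
     + corr a [D1, D3, D4] b [D1, D3, D4] 0 0 0 0 + corr a [D2, D3, D4] b [D2, D3, D4] 0 0 0 0"
  unfolding form_dot_def increasing_indices_eq
  by (simp_all add: corr_def shift_zero sum.distrib add.assoc)

lemma form3_diag:
  assumes "is_form 3 a"
  shows "a x [i, i, j] = 0" "a x [j, i, i] = 0" "a x [i, j, i] = 0"
  using form3_swap(1)[OF assms, of x i i j] form3_swap(2)[OF assms, of x j i i]
    form3_swap(1)[OF assms, of x i j i] by auto

text \<open>The minus sign comes from transposing the backward difference; moving the new index past
  the two old ones costs none.\<close>

lemma form_dot_codiff:
  assumes a: "is_form 3 a"
  shows "form_dot 2 (codiff a) b = - form_dot 3 a (ext_d b)"
proof -
  have cd: "codiff a x [i, j] = a x [i, j, D1] - a (x + shift (-1) 0 0 0) [i, j, D1]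
      + (a x [i, j, D2] - a (x + shift 0 (-1) 0 0) [i, j, D2])
      + (a x [i, j, D3] - a (x + shift 0 0 (-1) 0) [i, j, D3])
      + (a x [i, j, D4] - a (x + shift 0 0 0 (-1)) [i, j, D4])" for x i j
    by (simp add: codiff_def UNIV_dir shift_simps)
  have "corr (codiff a) [i, j] b K 0 0 0 0 =
      corr a [i, j, D1] b K 0 0 0 0 - corr a [i, j, D1] b K 1 0 0 0
    + (corr a [i, j, D2] b K 0 0 0 0 - corr a [i, j, D2] b K 0 1 0 0)
    + (corr a [i, j, D3] b K 0 0 0 0 - corr a [i, j, D3] b K 0 0 1 0)
    + (corr a [i, j, D4] b K 0 0 0 0 - corr a [i, j, D4] b K 0 0 0 1)" for i j K
    by (simp add: corr_def[of "codiff a"] cd shift_zero left_diff_distrib distrib_right sum.distrib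
        sum_subtractf corr_sum)
  moreover have "corr a [i, i, j] b K p q r s = 0" "corr a [j, i, i] b K p q r s = 0"
    "corr a [i, j, i] b K p q r s = 0" "i < j \<Longrightarrow> corr a [j, i, k] b K p q r s = - corr a [i, j, k] b K p q r s"
    "j < k \<Longrightarrow> corr a [i, k, j] b K p q r s = - corr a [i, j, k] b K p q r s" for i j k K p q r s
    by (simp_all add: corr_def form3_diag[OF a] form3_sort[OF a] sum_negf)
  ultimately show ?thesis
    by (simp add: form_dot_corr corr_ext_d_right_3)
qed

text \<open>Turns the inversion count of \<open>levi_civita\<close> into nested sums that the
  simplifier evaluates on concrete lists.\<close>

lemma card_pairs:
  "card {(i, j). i < j \<and> j < n \<and> P i j} = (\<Sum>j<n. \<Sum>i<j. if P i j then 1 else 0)" for n :: nat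
proof -
  have "{(i, j). i < j \<and> j < n \<and> P i j} = (\<lambda>(j, i). (i, j)) ` (SIGMA j:{..<n}. {i. i < j \<and> P i j})"
    by (auto simp: image_iff)
  also have "card \<dots> = card (SIGMA j:{..<n}. {i. i < j \<and> P i j})"
    by (rule card_image) (auto simp: inj_on_def)
  also have "\<dots> = (\<Sum>j<n. card {i \<in> {..<j}. P i j})"
    by (subst card_SigmaI) auto
  also have "\<dots> = (\<Sum>j<n. \<Sum>i<j. if P i j then 1 else 0)"
    by (intro sum.cong refl) (simp add: sum.If_cases Int_def)
  finally show ?thesis .
qed

lemma levi_civita_eq:
  "levi_civita \<mu>s = (if distinct \<mu>s then
     (-1) ^ (\<Sum>j<length \<mu>s. \<Sum>i<j. if \<mu>s ! j < \<mu>s ! i then 1 else 0) else 0)"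
  unfolding levi_civita_def card_pairs ..

lemma dual_to_loop_components:
  assumes "dual_to_loop l \<gamma>"
  shows "loop_form \<gamma> x [D1] = - ext_d l (x + shift 1 0 0 0) [D2, D3, D4]"
    "loop_form \<gamma> x [D2] = ext_d l (x + shift 0 1 0 0) [D1, D3, D4]"
    "loop_form \<gamma> x [D3] = - ext_d l (x + shift 0 0 1 0) [D1, D2, D4]"
    "loop_form \<gamma> x [D4] = ext_d l (x + shift 0 0 0 1) [D1, D2, D3]"
proof -
  have "levi_civita (\<mu> # \<nu>s) * ext_d l (x + unit_vec \<mu>) \<nu>s = - loop_form \<gamma> x [\<mu>]"
    if "\<nu>s \<in> increasing_indices 3" "\<mu> \<notin> set \<nu>s" for \<mu> \<nu>s
    using assms that by (auto simp: dual_to_loop_def)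
  from this[of "[D2, D3, D4]" D1] this[of "[D1, D3, D4]" D2] this[of "[D1, D2, D4]" D3]
    this[of "[D1, D2, D3]" D4]
  show "loop_form \<gamma> x [D1] = - ext_d l (x + shift 1 0 0 0) [D2, D3, D4]"
    "loop_form \<gamma> x [D2] = ext_d l (x + shift 0 1 0 0) [D1, D3, D4]"
    "loop_form \<gamma> x [D3] = - ext_d l (x + shift 0 0 1 0) [D1, D2, D4]"
    "loop_form \<gamma> x [D4] = ext_d l (x + shift 0 0 0 1) [D1, D2, D3]"
    by (simp_all add: increasing_indices_eq levi_civita_eq lessThan_Suc unit_vec_shift)
qed

text \<open>In \<open>A \<union> \<gamma>\<close> the link of \<open>\<gamma>\<close> sits at the far end of the cube of \<open>A\<close>, so that expressing \<open>\<gamma>\<close>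
  by \<open>dl\<close> evaluates \<open>dl\<close> at the opposite corner of the hypercube.\<close>

definition diagonal_translate :: "'n::finite form \<Rightarrow> 'n form" where
  "diagonal_translate a x \<mu>s = a (x + shift 1 1 1 1) \<mu>s"

lemma corr_diagonal_translate:
  "corr (diagonal_translate a) I b J p q r s = corr a I b J (p - 1) (q - 1) (r - 1) (s - 1)"
  "corr a I (diagonal_translate b) J p q r s = corr a I b J (p + 1) (q + 1) (r + 1) (s + 1)"
  by (simp_all add: corr_def[of "diagonal_translate a"] corr_def[of _ _ "diagonal_translate b"]
      diagonal_translate_def corr_sum shift_simps)

lemma ext_d_diagonal_translate: "ext_d (diagonal_translate a) = diagonal_translate (ext_d a)"
  by (simp add: fun_eq_iff ext_d_def diagonal_translate_def add_ac)

lemma is_form_diagonal_translate: "is_form r a \<Longrightarrow> is_form r (diagonal_translate a)"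
  by (simp add: is_form_def diagonal_translate_def)

lemma diagonal_translate_int_forms: "a \<in> int_forms r \<Longrightarrow> diagonal_translate a \<in> int_forms r"
  by (simp add: int_forms_def is_form_diagonal_translate) (simp add: diagonal_translate_def)

lemma pontryagin_diagonal_translate:
  assumes "is_form 2 a"
  shows "pontryagin (diagonal_translate a) = pontryagin a"
  by (simp add: pontryagin_def ext_d_diagonal_translate lattice_sum_cup_2_2 lattice_sum_cup1_2_3 assms
      is_form_diagonal_translate is_form_ext_d_2 corr_diagonal_translate)

lemma corr_scale:
  "corr (\<lambda>x \<mu>s. k * a x \<mu>s) I b J p q r s = k * corr a I b J p q r s"
  "corr a I (\<lambda>x \<mu>s. k * b x \<mu>s) J p q r s = k * corr a I b J p q r s"
  by (simp_all add: corr_def sum_distrib_left algebra_simps)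

lemma corr_loop_form:
  assumes "dual_to_loop l \<gamma>"
  shows "corr (loop_form \<gamma>) [D1] b J p q r s = - corr (ext_d l) [D2, D3, D4] b J (p - 1) q r s"
    "corr (loop_form \<gamma>) [D2] b J p q r s = corr (ext_d l) [D1, D3, D4] b J p (q - 1) r s"
    "corr (loop_form \<gamma>) [D3] b J p q r s = - corr (ext_d l) [D1, D2, D4] b J p q (r - 1) s"
    "corr (loop_form \<gamma>) [D4] b J p q r s = corr (ext_d l) [D1, D2, D3] b J p q r (s - 1)"
  by (simp_all add: corr_def[of "loop_form \<gamma>"] dual_to_loop_components[OF assms] sum_negf corr_sum)

lemma is_form_scale: "is_form r a \<Longrightarrow> is_form r (\<lambda>x \<mu>s. k * a x \<mu>s)"
  by (simp add: is_form_def)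

text \<open>The first two facts rewrite the magnetic part of the loops as a source for
  \<open>A\<^sup>m\<close>; the last two convert this source into electric charge once
  \<open>dn\<close> equals it. The mirrored product shows the same translate of \<open>dl\<close> in
  both roles, so the dual loop behaves like the other one with \<open>l\<close> translated.\<close>

lemma loop_cup_charge:
  assumes l: "is_form 2 l" and dual: "dual_to_loop l \<gamma>"
  shows "is_form 3 a \<Longrightarrow> lattice_sum (cup 1 3 (loop_form \<gamma>) a) = - form_dot 3 a (ext_d l)"
    and "is_form 3 a \<Longrightarrow>
      lattice_sum (cup 3 1 a (loop_form \<gamma>)) = form_dot 3 a (diagonal_translate (ext_d l))"
    and "lattice_sum (cup 1 3 a (\<lambda>x \<mu>s. k * ext_d l x \<mu>s)) = - k * form_dot 1 (loop_form \<gamma>) a"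
    and "lattice_sum (cup 3 1 (\<lambda>x \<mu>s. k * diagonal_translate (ext_d l) x \<mu>s) a)
      = k * form_dot 1 (loop_form \<gamma>) a"
proof -
  note dl = is_form_ext_d_2[OF l]
  note c = corr_commute[where a=a and b="loop_form \<gamma>"] corr_commute[where a=a and b="ext_d l"]
  show "is_form 3 a \<Longrightarrow> lattice_sum (cup 1 3 (loop_form \<gamma>) a) = - form_dot 3 a (ext_d l)"
    by (simp add: lattice_sum_cup_1_3 form_dot_corr corr_loop_form[OF dual] c del: One_nat_def)
  show "is_form 3 a \<Longrightarrow>
      lattice_sum (cup 3 1 a (loop_form \<gamma>)) = form_dot 3 a (diagonal_translate (ext_d l))"
    by (simp add: lattice_sum_cup_3_1 form_dot_corr corr_loop_form[OF dual] corr_diagonal_translate c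
        del: One_nat_def)
  show "lattice_sum (cup 1 3 a (\<lambda>x \<mu>s. k * ext_d l x \<mu>s)) = - k * form_dot 1 (loop_form \<gamma>) a"
    by (simp add: lattice_sum_cup_1_3[OF is_form_scale[OF dl]] form_dot_corr(1) corr_scale
        corr_loop_form[OF dual] c algebra_simps del: One_nat_def)
  show "lattice_sum (cup 3 1 (\<lambda>x \<mu>s. k * diagonal_translate (ext_d l) x \<mu>s) a)
      = k * form_dot 1 (loop_form \<gamma>) a"
    by (simp add: lattice_sum_cup_3_1[OF is_form_scale[OF is_form_diagonal_translate[OF dl]]]
        form_dot_corr(1) corr_scale corr_diagonal_translate corr_loop_form[OF dual] algebra_simps
        del: One_nat_def)
qed

lemma field_strength_eq: "field_strength A n = (\<lambda>x \<mu>s. ext_d A x \<mu>s + 2 * pi * n x \<mu>s)"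
  by (simp add: fun_eq_iff field_strength_def)

lemma form_dot_codiff_field_strength:
  assumes "is_form 3 Am" "is_form 1 Ae"
  shows "form_dot 2 (codiff Am) (field_strength Ae n) = - 2 * pi * form_dot 3 Am (ext_d n)"
proof -
  have "ext_d (field_strength Ae n) = (\<lambda>x \<mu>s. (2 * pi) * ext_d n x \<mu>s)"
    unfolding field_strength_eq ext_d_linear by (simp add: ext_d_ext_d[OF assms(2)])
  then have "form_dot 3 Am (ext_d (field_strength Ae n)) = 2 * pi * form_dot 3 Am (ext_d n)"
    by (simp only: form_dot_corr(3) corr_scale distrib_left)
  then show ?thesis by (simp add: form_dot_codiff[OF assms(1)])
qed

lemma lattice_sum_cup_field_strength:
  assumes A: "is_form 1 A" and n: "is_form 2 n"
  shows "lattice_sum (cup 2 2 (field_strength A n) (field_strength A n)) =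
     2 * pi * (lattice_sum (cup 1 3 A (ext_d n)) - lattice_sum (cup 3 1 (ext_d n) A))
     + 4 * pi\<^sup>2 * lattice_sum (cup 2 2 n n)"
proof -
  have dA: "is_form 2 (ext_d A)" by (rule is_form_ext_d_1[OF A])
  have "lattice_sum (cup 1 3 A (\<lambda>_ _. 0)) = 0"
    by (simp add: lattice_sum_cup_1_3 is_form_zero corr_zero del: One_nat_def)
  then have "lattice_sum (cup 2 2 (ext_d A) (ext_d A)) = 0"
    using lattice_sum_cup_ext_d_left[OF A dA] ext_d_ext_d[OF A] by simp
  then show ?thesis
    unfolding field_strength_eq lattice_sum_cup_linear_left[OF dA n is_form_linear[OF dA n]]
      lattice_sum_cup_linear_right[OF dA dA n] lattice_sum_cup_linear_right[OF n dA n]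
    by (simp add: lattice_sum_cup_ext_d_left[OF A n] lattice_sum_cup_ext_d_right[OF A n]
        algebra_simps power2_eq_square)
qed

lemma lattice_sum_cup1_field_strength:
  assumes A: "is_form 1 A" and n: "is_form 2 n"
  shows "lattice_sum (cup1 2 3 (field_strength A n) (ext_d n)) =
     lattice_sum (cup 1 3 A (ext_d n)) + lattice_sum (cup 3 1 (ext_d n) A)
     + 2 * pi * lattice_sum (cup1 2 3 n (ext_d n))"
proof -
  have dA: "is_form 2 (ext_d A)" by (rule is_form_ext_d_1[OF A])
  show ?thesis
    unfolding field_strength_eq lattice_sum_cup1_linear_left[OF dA n is_form_ext_d_2[OF n]]
      lattice_sum_cup1_closed[OF dA n ext_d_ext_d[OF A]]
    by (simp add: lattice_sum_cup_ext_d_left[OF A n] lattice_sum_cup_ext_d_right[OF A n])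
qed

text \<open>The mixed terms enter \<open>F \<union> F\<close> as
  \<open>A \<union> dn - dn \<union> A\<close> and the \<open>cup1\<close> term as their sum. The
  coefficients 1/(8\<pi>^2) and 1/(4\<pi>) are matched so that one order cancels: the plus sign
  keeps \<open>A \<union> dn\<close>, the minus sign keeps \<open>- dn \<union> A\<close>. The minus
  sign also reverses the \<open>cup1\<close> part of the Pontryagin square, whence the extra term in
  the dual charge.\<close>

lemma top_charge_eq:
  assumes "is_form 1 A" "is_form 2 n"
  shows "2 * pi * top_charge (field_strength A n) n = pi * pontryagin n + lattice_sum (cup 1 3 A (ext_d n))"
    and "2 * pi * dual_top_charge (field_strength A n) n
      = pi * pontryagin n - 2 * pi * lattice_sum (cup1 2 3 n (ext_d n)) - lattice_sum (cup 3 1 (ext_d n) A)"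
  unfolding top_charge_def dual_top_charge_def pontryagin_def
    lattice_sum_cup_field_strength[OF assms] lattice_sum_cup1_field_strength[OF assms]
  by (simp_all add: field_simps power2_eq_square)

section \<open>The functional integral\<close>

lemma finite_increasing_indices: "finite (increasing_indices r)"
  by (rule finite_subset[OF _ finite_lists_length_eq[of UNIV r]]) (auto simp: increasing_indices_def)

lemma finite_components: "finite (components r :: ('n::finite site \<times> dir list) set)"
  by (simp add: components_def finite_increasing_indices)

lemma increasing_indicesD:
  assumes "\<mu>s \<in> increasing_indices r"
  shows "length \<mu>s = r" "distinct \<mu>s" "sort \<mu>s = \<mu>s" "levi_civita \<mu>s = 1"
proof -
  have s: "sorted_wrt (<) \<mu>s" and "length \<mu>s = r" using assms by (auto simp: increasing_indices_def)
  then show "length \<mu>s = r" "distinct \<mu>s" "sort \<mu>s = \<mu>s"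
    by (auto simp: strict_sorted_iff sorted_sort_id)
  have "{(i, j). i < j \<and> j < length \<mu>s \<and> \<mu>s ! j < \<mu>s ! i} = {}"
    using sorted_wrt_nth_less[OF s] by (auto dest: less_asym)
  then show "levi_civita \<mu>s = 1"
    by (simp only: levi_civita_def \<open>distinct \<mu>s\<close> if_True card.empty power_0)
qed

lemma form_of_component: "\<mu>s \<in> increasing_indices r \<Longrightarrow> form_of r A x \<mu>s = A (x, \<mu>s)"
  by (simp add: form_of_def increasing_indicesD)

lemma form_dot_form_of:
  "form_dot r (form_of r A) b = (\<Sum>c\<in>components r. A c * b (fst c) (snd c))"
  by (simp add: form_dot_def components_def sum.cartesian_product form_of_component case_prod_unfold)

lemma is_form_form_of_1: "is_form 1 (form_of 1 A)"
  by (rule is_formI1) (simp add: form_of_def)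

lemma levi_civita_swap:
  "levi_civita [j, i, k] = - levi_civita [i, j, k]" "levi_civita [i, k, j] = - levi_civita [i, j, k]"
  by (cases i; cases j; cases k; simp add: levi_civita_eq lessThan_Suc)+

lemma is_form_form_of_3: "is_form 3 (form_of 3 A)"
proof (rule is_formI3)
  have "sort [j, i, k] = sort [i, j, k]" "sort [i, k, j] = sort [i, j, k]" for i j k :: dir
    by (auto intro!: properties_for_sort simp: add_mset_commute)
  then show "form_of 3 A x [j, i, k] = - form_of 3 A x [i, j, k]"
    "form_of 3 A x [i, k, j] = - form_of 3 A x [i, j, k]" for x i j k
    using levi_civita_swap[of i j k] by (simp_all add: form_of_def)
qed (simp add: form_of_def)

section \<open>Integration over the angles\<close>

abbreviation uniform_angle :: "real measure" where
  "uniform_angle \<equiv> uniform_measure lborel {-pi..<pi}"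

lemma prob_space_uniform_angle: "prob_space uniform_angle"
  by (rule prob_space_uniform_measure) (simp_all add: pi_ge_zero)

lemma uniform_angle_density: "uniform_angle = density lborel (\<lambda>x. indicator {-pi..<pi} x / (2 * pi))"
proof -
  have "indicator {-pi..<pi} x / emeasure lborel {-pi..<pi} = ennreal (indicator {-pi..<pi} x / (2 * pi))"
    for x :: real
    by (auto simp: indicator_def divide_ennreal[symmetric] ennreal_1[symmetric] simp del: ennreal_1)
  then show ?thesis by (simp add: uniform_measure_def)
qed

lemma integral_uniform_angle_exp:
  assumes "m \<noteq> 0"
  shows "(LINT x|uniform_angle. exp (\<i> * of_real (x * of_int m))) = 0"
proof -
  let ?f = "\<lambda>x::real. exp (\<i> * of_real (x * of_int m))"
  let ?F = "\<lambda>x::real. exp (\<i> * of_real (x * of_int m)) / (\<i> * of_int m)"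
  have "(?F has_vector_derivative ?f x) (at x within {-pi..pi})" for x
    unfolding has_real_derivative_iff_has_vector_derivative[symmetric]
    using assms by (auto intro!: derivative_eq_intros has_vector_derivative_real_field simp: field_simps)
  then have "(?f has_integral ?F pi - ?F (-pi)) {-pi..pi}"
    by (intro fundamental_theorem_of_calculus) auto
  moreover have "?F pi = ?F (-pi)"
  proof -
    have "exp (\<i> * of_real (pi * of_int m)) = exp (\<i> * of_real (- pi * of_int m) + 2 * of_int m * of_real pi * \<i>)"
      by (simp add: algebra_simps)
    also have "\<dots> = exp (\<i> * of_real (- pi * of_int m))"
      by (subst exp_add) (use exp_integer_2pi[of "of_int m"] in \<open>simp add: algebra_simps\<close>)
    finally show ?thesis by simp
  qed
  ultimately have I: "integral {-pi..pi} ?f = 0" by (simp add: integral_unique)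
  have "set_integrable lborel {-pi..pi} ?f"
    by (intro borel_integrable_atLeastAtMost' continuous_intros)
  then have *: "(LINT x:{-pi..pi}|lborel. ?f x) = 0"
    using set_borel_integral_eq_integral(2) I by metis
  have "(LINT x|uniform_angle. ?f x) = (LINT x|lborel. (indicator {-pi..<pi} x / (2 * pi)) *\<^sub>R ?f x)"
    unfolding uniform_angle_density by (rule integral_density) auto
  also have "\<dots> = (LINT x|lborel. (1 / (2 * pi)) *\<^sub>R (indicator {-pi..pi} x *\<^sub>R ?f x))"
    \<comment> \<open>The half-open and the closed interval differ by a null set, the right end
      point.\<close>
    by (rule integral_cong_AE) (use AE_lborel_singleton[of pi] in \<open>auto simp: indicator_def\<close>)
  also have "\<dots> = (1 / (2 * pi)) *\<^sub>R (LINT x:{-pi..pi}|lborel. ?f x)"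
    unfolding set_lebesgue_integral_def by (rule integral_scaleR_right)
  also have "\<dots> = 0" using * by simp
  finally show ?thesis .
qed

lemma prob_space_gauge_measure: "prob_space (gauge_measure r)"
  unfolding gauge_measure_def by (intro prob_space_PiM prob_space_uniform_angle)

text \<open>The integral factorises over components, and a single non-zero integer component already
  gives a vanishing factor. Integration over \<open>A\<^sup>m\<close> is thus a Kronecker delta on
  integer forms.\<close>

lemma integral_gauge_measure_character:
  fixes k :: "'n::finite form"
  assumes k: "k \<in> int_forms 3"
  shows "(LINT A|gauge_measure 3. exp (\<i> * of_real (form_dot 3 (form_of 3 A) k)))
    = (if k = (\<lambda>_ _. 0) then 1 else 0)"
proof (cases "k = (\<lambda>_ _. 0)")
  case True
  interpret prob_space "gauge_measure 3 :: (('n site \<times> dir list) \<Rightarrow> real) measure"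
    by (rule prob_space_gauge_measure)
  show ?thesis using True by (simp add: form_dot_def prob_space)
next
  case False
  have kf: "is_form 3 k" and kint: "k x \<mu>s \<in> \<int>" for x \<mu>s using k by (auto simp: int_forms_def)
  obtain x \<mu>s where "\<mu>s \<in> increasing_indices 3" "k x \<mu>s \<noteq> 0"
    using form3_eq_zeroI[OF kf] False by (auto simp: increasing_indices_eq)
  then obtain c where c: "c \<in> components 3" "k (fst c) (snd c) \<noteq> 0"
    by (auto simp: components_def)
  interpret P: prob_space uniform_angle by (rule prob_space_uniform_angle)
  interpret product_sigma_finite "\<lambda>_ :: 'n site \<times> dir list. uniform_angle"
    by (rule product_sigma_finite.intro) (rule P.sigma_finite_measure_axioms)
  let ?e = "\<lambda>c (a::real). exp (\<i> * of_real (a * k (fst c) (snd c)))"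
  have "(LINT A|gauge_measure 3. exp (\<i> * of_real (form_dot 3 (form_of 3 A) k)))
      = (LINT A|gauge_measure 3. (\<Prod>c\<in>components 3. ?e c (A c)))"
    by (simp add: form_dot_form_of sum_distrib_left exp_sum finite_components)
  also have "\<dots> = (\<Prod>c\<in>components 3. LINT a|uniform_angle. ?e c a)"
    unfolding gauge_measure_def
  proof (rule product_integral_prod)
    show "integrable uniform_angle (?e c)" for c
      by (rule P.integrable_const_bound[where B=1]) auto
  qed (rule finite_components)
  also have "\<dots> = 0"
  proof (rule prod_zero)
    obtain m where m: "k (fst c) (snd c) = of_int m" using kint by (metis Ints_cases)
    with c have "m \<noteq> 0" by auto
    from integral_uniform_angle_exp[OF this] m
    show "\<exists>c\<in>components 3. (LINT a|uniform_angle. ?e c a) = 0"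
      using c(1) by (intro bexI[of _ c]) simp_all
  qed (rule finite_components)
  finally show ?thesis using False by simp
qed

text \<open>The estimate by \<open>K x * B n\<close> holds for every \<open>x\<close> and gives
  summability in \<open>n\<close> pointwise, while \<open>K\<close> is bounded only almost
  everywhere: the product space also contains angles outside the interval.\<close>

lemma integral_infsum:
  fixes f :: "'i \<Rightarrow> 'a \<Rightarrow> complex"
  assumes M: "finite_measure M" and S: "countable S"
    and meas: "\<And>n. n \<in> S \<Longrightarrow> f n \<in> borel_measurable M"
    and bound: "\<And>n x. n \<in> S \<Longrightarrow> norm (f n x) \<le> K x * B n" "AE x in M. K x \<le> C"
    and B: "B summable_on S" "\<And>n. B n \<ge> 0"
  shows "(LINT x|M. infsum (\<lambda>n. f n x) S) = infsum (\<lambda>n. LINT x|M. f n x) S"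
proof -
  interpret finite_measure M by (rule M)
  have bound': "AE x in M. \<forall>n\<in>S. norm (f n x) \<le> C * B n"
    using bound(2)
  proof eventually_elim
    case (elim x)
    show ?case using bound(1) mult_right_mono[OF elim B(2)] by (blast intro: order_trans)
  qed
  have int: "integrable M (f n)" if "n \<in> S" for n
    using that bound' by (intro integrable_const_bound[where B="C * B n"] meas) (auto elim!: eventually_mono)
  show ?thesis
  proof (cases "finite S")
    case True
    then show ?thesis using int by (simp add: integral_sum)
  next
    case False
    \<comment> \<open>Enumerating \<open>S\<close> turns the unordered sum into a series, the
      setting of \<open>integral_suminf\<close>.\<close>
    define e where "e = from_nat_into S"
    have e: "bij_betw e UNIV S" unfolding e_def by (rule bij_betw_from_nat_into[OF S False])
    then have eS: "e i \<in> S" for i by (auto simp: bij_betw_def)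
    have sB: "summable (\<lambda>i. B (e i))"
      using B(1) summable_on_reindex_bij_betw[OF e, of B] by (auto intro: summable_on_imp_summable)
    have infsum_eq: "infsum g S = (\<Sum>i. g (e i))" if "summable (\<lambda>i. norm (g (e i)))" for g :: "'i \<Rightarrow> complex"
    proof -
      have "((\<lambda>i. g (e i)) has_sum infsum (\<lambda>i. g (e i)) UNIV) UNIV"
        by (rule has_sum_infsum) (rule norm_summable_imp_summable_on[OF that])
      then show ?thesis
        using has_sum_imp_sums sums_unique infsum_reindex_bij_betw[OF e, of g] by metis
    qed
    have sx: "summable (\<lambda>i. norm (f (e i) x))" for x
      by (rule summable_comparison_test'[OF summable_mult[OF sB, of "K x"], of 0]) (use eS bound(1) in auto)
    have le: "(LINT x|M. norm (f (e i) x)) \<le> C * B (e i) * measure M (space M)" for i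
    proof -
      have "(LINT x|M. norm (f (e i) x)) \<le> (LINT x|M. C * B (e i))"
        using bound' eS by (intro integral_mono_AE integrable_norm int) (auto elim!: eventually_mono)
      then show ?thesis by (simp add: mult_ac)
    qed
    have sI: "summable (\<lambda>i. LINT x|M. norm (f (e i) x))"
      by (rule summable_comparison_test'[OF summable_mult2[OF summable_mult[OF sB, of C],
            of "measure M (space M)"], of 0]) (use le in auto)
    have "(LINT x|M. infsum (\<lambda>n. f n x) S) = (LINT x|M. (\<Sum>i. f (e i) x))"
      by (simp add: infsum_eq[OF sx])
    also have "\<dots> = (\<Sum>i. LINT x|M. f (e i) x)"
      by (rule integral_suminf[OF int[OF eS] AE_I2[OF sx] sI])
    also have "\<dots> = infsum (\<lambda>n. LINT x|M. f n x) S"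
      by (rule infsum_eq[symmetric], rule summable_comparison_test'[OF sI, of 0]) (simp add: integral_norm_bound)
    finally show ?thesis .
  qed
qed

section \<open>Sums over integer 2-forms\<close>

lemma summable_on_exp_abs_int:
  assumes "c > 0"
  shows "(\<lambda>m::int. exp (- c * \<bar>real_of_int m\<bar>)) summable_on UNIV"
proof -
  let ?f = "\<lambda>m::int. exp (- c * \<bar>real_of_int m\<bar>)"
  have geo: "(\<lambda>n::nat. exp (- c * real n)) summable_on UNIV"
  proof -
    have "(\<lambda>n. exp (- c * real n)) = (\<lambda>n. exp (- c) ^ n)"
      by (simp add: exp_of_nat_mult[symmetric] mult.commute)
    then show ?thesis
      using assms by (subst summable_on_UNIV_nonneg_real_iff) (auto intro!: summable_geometric)
  qed
  have 1: "?f summable_on range int"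
    using geo by (subst summable_on_reindex) (simp_all add: o_def)
  have 2: "?f summable_on range (\<lambda>n. - int n)"
    using geo by (subst summable_on_reindex) (simp_all add: o_def inj_on_def)
  have "UNIV = range int \<union> (range (\<lambda>n. - int n) - {0})"
    by (auto simp: image_iff) (metis int_cases2)
  moreover have "?f summable_on \<dots>"
    by (rule summable_on_Un_disjoint[OF 1 summable_on_subset_banach[OF 2]]) auto
  ultimately show ?thesis by simp
qed

lemma form2_eqI:
  assumes a: "is_form 2 a" and b: "is_form 2 b"
    and eq: "\<And>x \<mu>s. \<mu>s \<in> increasing_indices 2 \<Longrightarrow> a x \<mu>s = b x \<mu>s"
  shows "a = b"
proof (intro ext)
  fix x \<mu>s
  have "a x [i, i] = 0" "b x [i, i] = 0" for i
    using form2_swap[OF a, of x i i] form2_swap[OF b, of x i i] by auto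
  moreover have "a x [i, j] = b x [i, j]" if "i < j" for i j
    using that by (intro eq) (simp add: increasing_indices_def)
  ultimately have "a x [i, j] = b x [i, j]" for i j
    by (cases i j rule: linorder_cases) (simp_all add: form2_sort[OF a] form2_sort[OF b])
  then show "a x \<mu>s = b x \<mu>s"
    using is_form_length[OF a, of \<mu>s x] is_form_length[OF b, of \<mu>s x]
    by (cases "length \<mu>s = 2") (auto simp: numeral_2_eq_2 length_Suc_conv)
qed

text \<open>\<open>restrict\<close> makes the values extensional, so that the forms embed into a
  finite product of copies of the integers, over which sums factorise.\<close>

definition integer_components :: "'n::finite form \<Rightarrow> 'n site \<times> dir list \<Rightarrow> int" where
  "integer_components n = restrict (\<lambda>c. \<lfloor>n (fst c) (snd c)\<rfloor>) (components 2)"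

lemma integer_components_eq:
  assumes "n \<in> int_forms 2" "c \<in> components 2"
  shows "real_of_int (integer_components n c) = n (fst c) (snd c)"
proof -
  have "n (fst c) (snd c) \<in> \<int>" using assms(1) by (simp add: int_forms_def)
  then show ?thesis using assms(2) by (auto simp: integer_components_def elim: Ints_cases)
qed

lemma inj_on_integer_components: "inj_on integer_components (int_forms 2 :: 'n::finite form set)"
proof (rule inj_onI)
  fix a b :: "'n form"
  assume ab: "a \<in> int_forms 2" "b \<in> int_forms 2" "integer_components a = integer_components b"
  show "a = b"
  proof (rule form2_eqI)
    show "a x \<mu>s = b x \<mu>s" if "\<mu>s \<in> increasing_indices 2" for x \<mu>s
      using that ab(3) integer_components_eq[OF ab(1), of "(x, \<mu>s)"]
        integer_components_eq[OF ab(2), of "(x, \<mu>s)"] by (simp add: components_def)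
  qed (use ab in \<open>auto simp: int_forms_def\<close>)
qed

lemma integer_components_range:
  "integer_components ` int_forms 2 \<subseteq> (\<Pi>\<^sub>E c\<in>components 2. UNIV)"
  by (auto simp: integer_components_def)

lemma countable_int_forms: "countable (int_forms 2 :: 'n::finite form set)"
proof -
  have "countable (\<Pi>\<^sub>E c\<in>(components 2 :: ('n site \<times> dir list) set). (UNIV :: int set))"
    by (rule countable_PiE) (simp_all add: finite_components)
  then have "countable (integer_components ` (int_forms 2 :: 'n form set))"
    using integer_components_range countable_subset by blast
  then show ?thesis using inj_on_integer_components countable_image_inj_on by blast
qed

text \<open>Over all integer functions on the components the sum is a product of two-sided geometric
  series; the forms are a part of these functions.\<close>

lemma summable_on_int_forms:
  assumes "c > 0"
  shows "(\<lambda>n::'n::finite form. \<Prod>p\<in>components 2. exp (- c * \<bar>n (fst p) (snd p)\<bar>)) summable_on int_forms 2"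
proof -
  let ?g = "\<lambda>m::int. exp (- c * \<bar>real_of_int m\<bar>)"
  let ?P = "\<lambda>h. \<Prod>p\<in>(components 2 :: ('n site \<times> dir list) set). ?g (h p)"
  have "Infinite_Set_Sum.abs_summable_on ?g UNIV"
    using summable_on_exp_abs_int[OF assms] by (simp add: abs_summable_equivalent[symmetric])
  then have "Infinite_Set_Sum.abs_summable_on ?P (\<Pi>\<^sub>E p\<in>components 2. UNIV)"
    by (intro abs_summable_on_prod_PiE) (simp_all add: finite_components)
  then have "(\<lambda>h. norm (?P h)) summable_on (\<Pi>\<^sub>E p\<in>components 2. UNIV)"
    by (simp add: abs_summable_equivalent[symmetric])
  then have "?P summable_on (\<Pi>\<^sub>E p\<in>components 2. UNIV)"
    by (simp add: prod_nonneg)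
  then have "?P summable_on integer_components ` (int_forms 2 :: 'n form set)"
    using integer_components_range by (rule summable_on_subset_banach)
  then have "(?P \<circ> integer_components) summable_on (int_forms 2 :: 'n form set)"
    by (simp add: summable_on_reindex[OF inj_on_integer_components])
  then show ?thesis
    by (rule summable_on_cong[THEN iffD1, rotated]) (simp add: integer_components_eq)
qed

lemma measurable_form_of:
  "(\<lambda>A. form_of r A x \<mu>s) \<in> borel_measurable (gauge_measure r)"
proof (cases "length \<mu>s = r \<and> distinct \<mu>s")
  case True
  then have "(x, sort \<mu>s) \<in> components r"
    by (auto simp: components_def increasing_indices_def strict_sorted_iff)
  then have "(\<lambda>A. A (x, sort \<mu>s)) \<in> measurable (gauge_measure r) uniform_angle"
    unfolding gauge_measure_def by (rule measurable_component_singleton)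
  then have "(\<lambda>A. A (x, sort \<mu>s)) \<in> borel_measurable (gauge_measure r)"
    by (simp cong: measurable_cong_sets)
  then show ?thesis by (simp add: form_of_def)
next
  case False
  \<comment> \<open>Lists of the wrong length or with a repeated index name no integration variable;
    the form vanishes on them by definition.\<close>
  then have "(\<lambda>A. form_of r A x \<mu>s) = (\<lambda>_. 0)"
    by (auto simp: form_of_def levi_civita_def fun_eq_iff)
  then show ?thesis by simp
qed

section \<open>Gaussian integrands and their domination\<close>

lemma AE_gauge_measure_bounded:
  "AE A in gauge_measure r :: ('n::finite site \<times> dir list \<Rightarrow> real) measure. \<forall>c\<in>components r. \<bar>A c\<bar> \<le> pi"
proof -
  have "AE A in gauge_measure r. \<bar>A c\<bar> \<le> pi" if "c \<in> components r" for c :: "'n site \<times> dir list"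
    unfolding gauge_measure_def
  proof (rule AE_PiM_component[where P="\<lambda>a. \<bar>a\<bar> \<le> pi", OF prob_space_uniform_angle that])
    have "AE a in uniform_angle. a \<in> {-pi..<pi}"
      by (rule AE_uniform_measureI) auto
    then show "AE a in uniform_angle. \<bar>a\<bar> \<le> pi" by (rule AE_mp) auto
  qed
  then show ?thesis by (subst AE_finite_all) (simp_all add: finite_components)
qed

text \<open>Common shape of all numerators and of the partition function: a real weight, a phase
  \<phi> independent of \<open>Am\<close>, and a coupling of \<open>Am\<close> to the 3-form
  \<open>k n\<close>, whose vanishing becomes the constraint.\<close>

definition gaussian_integrand :: "real \<Rightarrow> ('n::finite form \<Rightarrow> 'n form \<Rightarrow> real) \<Rightarrow> ('n form \<Rightarrow> 'n form)
    \<Rightarrow> 'n form \<Rightarrow> 'n form \<Rightarrow> 'n form \<Rightarrow> complex" where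
  "gaussian_integrand \<beta> \<phi> k Ae Am n =
     exp (of_real (- (\<beta> / 2 * form_dot 2 (field_strength Ae n) (field_strength Ae n))))
     * exp (\<i> * of_real (\<phi> Ae n)) * exp (\<i> * of_real (form_dot 3 Am (k n)))"

definition gaussian_bound :: "real \<Rightarrow> ('n::finite site \<times> dir list \<Rightarrow> real) \<Rightarrow> real" where
  "gaussian_bound \<beta> A = exp (\<beta> / 2 * form_dot 2 (ext_d (form_of 1 A)) (ext_d (form_of 1 A)))"

text \<open>In each component (a + 2\<pi>n)^2 \<ge> 2\<pi>^2 n^2 - a^2, and |n| \<le> n^2 for
  integers; this separates the gauge field from \<open>n\<close>. The factor \<beta>/2 turns
  2\<pi>^2 into the rate \<open>\<beta> * pi\<^sup>2\<close>. The price is the growing factor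
  \<open>gaussian_bound\<close>, harmless for bounded angles.\<close>

lemma norm_gaussian_integrand_le:
  assumes "\<beta> > 0" and n: "n \<in> int_forms 2"
  shows "norm (gaussian_integrand \<beta> \<phi> k (form_of 1 A) Am n)
    \<le> gaussian_bound \<beta> A * (\<Prod>p\<in>components 2. exp (- (\<beta> * pi\<^sup>2) * \<bar>n (fst p) (snd p)\<bar>))"
proof -
  let ?a = "\<lambda>p. ext_d (form_of 1 A) (fst p) (snd p)" and ?n = "\<lambda>p. n (fst p) (snd p)"
  have dot: "form_dot 2 b b = (\<Sum>p\<in>components 2. (b (fst p) (snd p))\<^sup>2)" for b :: "'a form"
    by (simp add: form_dot_def components_def sum.cartesian_product case_prod_unfold power2_eq_square)
  have *: "- (\<beta> / 2 * (?a p + 2 * pi * ?n p)\<^sup>2) \<le> \<beta> / 2 * (?a p)\<^sup>2 + - (\<beta> * pi\<^sup>2) * \<bar>?n p\<bar>" for p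
  proof -
    have "?n p \<in> \<int>" using n by (simp add: int_forms_def)
    then obtain m where m: "?n p = of_int m" by (rule Ints_cases)
    have "\<bar>m\<bar> \<le> m\<^sup>2" using self_le_power[of "\<bar>m\<bar>" 2] by (cases "m = 0") auto
    then have "\<bar>real_of_int m\<bar> \<le> (real_of_int m)\<^sup>2"
      by (metis of_int_abs of_int_le_iff of_int_power)
    then have 1: "(2 * pi\<^sup>2) * \<bar>?n p\<bar> \<le> (2 * pi\<^sup>2) * (?n p)\<^sup>2"
      unfolding m by (intro mult_left_mono) auto
    \<comment> \<open>This half square is the difference of the two sides of the next
      inequality.\<close>
    have "0 \<le> 1 / 2 * (2 * ?a p + 2 * pi * ?n p)\<^sup>2" by simp
    then have "(2 * pi\<^sup>2) * (?n p)\<^sup>2 - (?a p)\<^sup>2 \<le> (?a p + 2 * pi * ?n p)\<^sup>2"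
      by (simp add: power2_eq_square algebra_simps)
    with 1 have "(2 * pi\<^sup>2) * \<bar>?n p\<bar> - (?a p)\<^sup>2 \<le> (?a p + 2 * pi * ?n p)\<^sup>2" by linarith
    then have "\<beta> / 2 * ((2 * pi\<^sup>2) * \<bar>?n p\<bar> - (?a p)\<^sup>2) \<le> \<beta> / 2 * (?a p + 2 * pi * ?n p)\<^sup>2"
      using assms(1) by (intro mult_left_mono) auto
    then show ?thesis by (simp add: algebra_simps)
  qed
  have "norm (gaussian_integrand \<beta> \<phi> k (form_of 1 A) Am n)
      = exp (\<Sum>p\<in>components 2. - (\<beta> / 2 * (?a p + 2 * pi * ?n p)\<^sup>2))"
    by (simp add: gaussian_integrand_def norm_mult dot field_strength_def sum_distrib_left sum_negf)
  also have "\<dots> \<le> exp (\<Sum>p\<in>components 2. \<beta> / 2 * (?a p)\<^sup>2 + - (\<beta> * pi\<^sup>2) * \<bar>?n p\<bar>)"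
    using * by (intro exp_le_cancel_iff[THEN iffD2] sum_mono)
  also have "\<dots> = gaussian_bound \<beta> A * (\<Prod>p\<in>components 2. exp (- (\<beta> * pi\<^sup>2) * \<bar>?n p\<bar>))"
    by (simp only: gaussian_bound_def dot sum.distrib exp_add exp_sum[OF finite_components] sum_distrib_left)
  finally show ?thesis .
qed

lemma AE_gaussian_bound:
  assumes "\<beta> > 0"
  obtains C where "AE A in gauge_measure 1. gaussian_bound \<beta> (A :: 'n::finite site \<times> dir list \<Rightarrow> real) \<le> C"
proof -
  have bound: "gaussian_bound \<beta> A \<le> exp (\<beta> / 2 * (\<Sum>x\<in>(UNIV::'n site set). \<Sum>\<mu>s\<in>increasing_indices 2. (4 * pi)\<^sup>2))"
    if A: "\<forall>c\<in>components 1. \<bar>A c\<bar> \<le> pi" for A :: "'n site \<times> dir list \<Rightarrow> real"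
  proof -
    have A1: "\<bar>form_of 1 A x [i]\<bar> \<le> pi" for x i
    proof -
      have "[i] \<in> increasing_indices 1" by (simp add: increasing_indices_def)
      then show ?thesis using A by (simp add: form_of_component components_def del: One_nat_def)
    qed
    have sq: "(ext_d (form_of 1 A) x \<mu>s)\<^sup>2 \<le> (4 * pi)\<^sup>2" if \<mu>s: "\<mu>s \<in> increasing_indices 2" for x \<mu>s
    proof -
      obtain i j where ij: "\<mu>s = [i, j]"
        using \<mu>s by (auto simp: increasing_indices_eq)
      \<comment> \<open>A plaquette has four links, each with an angle of size at most
        \<pi>.\<close>
      have "\<bar>ext_d (form_of 1 A) x [i, j]\<bar> \<le> 4 * pi"
        using A1[of "x + unit_vec i" j] A1[of x j] A1[of "x + unit_vec j" i] A1[of x i]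
        unfolding ext_d_2 by linarith
      then show ?thesis unfolding ij by (metis abs_le_square_iff abs_of_nonneg abs_ge_zero order_trans)
    qed
    have "form_dot 2 (ext_d (form_of 1 A)) (ext_d (form_of 1 A))
        \<le> (\<Sum>x\<in>(UNIV::'n site set). \<Sum>\<mu>s\<in>increasing_indices 2. (4 * pi)\<^sup>2)"
      unfolding form_dot_def power2_eq_square[symmetric] by (intro sum_mono sq)
    then show ?thesis
      unfolding gaussian_bound_def
      using assms by (intro exp_le_cancel_iff[THEN iffD2] mult_left_mono) auto
  qed
  have "AE A in gauge_measure 1. gaussian_bound \<beta> (A :: 'n site \<times> dir list \<Rightarrow> real)
      \<le> exp (\<beta> / 2 * (\<Sum>x\<in>(UNIV::'n site set). \<Sum>\<mu>s\<in>increasing_indices 2. (4 * pi)\<^sup>2))"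
    using AE_gauge_measure_bounded by (rule eventually_mono) (rule bound)
  then show ?thesis by (rule that)
qed

text \<open>Once the sum stands outside, Fubini leaves a character integral over \<open>Am\<close>
  for each \<open>n\<close>. The zero arguments in the remaining integral set the last factor of
  \<open>gaussian_integrand\<close> to 1.\<close>

lemma path_integral_gaussian:
  fixes \<phi> :: "'n::finite form \<Rightarrow> 'n form \<Rightarrow> real"
  assumes \<beta>: "\<beta> > 0"
    and meas: "\<And>n. n \<in> int_forms 2 \<Longrightarrow> (\<lambda>A. \<phi> (form_of 1 A) n) \<in> borel_measurable (gauge_measure 1)"
    and k: "\<And>n. n \<in> int_forms 2 \<Longrightarrow> k n \<in> int_forms 3"
  shows "path_integral (gaussian_integrand \<beta> \<phi> k) =
    infsum (\<lambda>n. if k n = (\<lambda>_ _. 0)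
      then LINT A|gauge_measure 1. gaussian_integrand \<beta> \<phi> (\<lambda>_ _ _. 0) (form_of 1 A) (\<lambda>_ _. 0) n
      else 0) (int_forms 2)"
proof -
  let ?M1 = "gauge_measure 1 :: ('n site \<times> dir list \<Rightarrow> real) measure"
  let ?M3 = "gauge_measure 3 :: ('n site \<times> dir list \<Rightarrow> real) measure"
  interpret M1: prob_space ?M1 by (rule prob_space_gauge_measure)
  interpret M3: prob_space ?M3 by (rule prob_space_gauge_measure)
  interpret P: pair_prob_space ?M1 ?M3 ..
  define f where "f n A = gaussian_integrand \<beta> \<phi> k (form_of 1 (fst A)) (form_of 3 (snd A)) n" for n A
  note [measurable] = measurable_form_of measurable_compose[OF measurable_fst measurable_form_of]
    measurable_compose[OF measurable_snd measurable_form_of]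
  have [measurable]: "(\<lambda>A. gaussian_bound \<beta> A) \<in> borel_measurable ?M1"
    unfolding gaussian_bound_def form_dot_def ext_d_def by measurable
  have fm: "f n \<in> borel_measurable (?M1 \<Otimes>\<^sub>M ?M3)" if n: "n \<in> int_forms 2" for n
  proof -
    note [measurable] = meas[OF n] measurable_compose[OF measurable_fst meas[OF n]]
    show ?thesis
      unfolding f_def gaussian_integrand_def form_dot_def field_strength_def ext_d_def by measurable
  qed
  obtain C where C: "AE A in ?M1. gaussian_bound \<beta> A \<le> C" using AE_gaussian_bound[OF \<beta>] .
  have "AE A in (?M1 \<Otimes>\<^sub>M ?M3). gaussian_bound \<beta> (fst A) \<le> C"
    by (rule P.AE_pair_measure, measurable) (use C in \<open>auto elim!: eventually_mono\<close>)
  then have "path_integral (gaussian_integrand \<beta> \<phi> k) = infsum (\<lambda>n. LINT A|(?M1 \<Otimes>\<^sub>M ?M3). f n A) (int_forms 2)"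
    unfolding path_integral_def f_def[symmetric]
  proof (intro integral_infsum P.finite_measure_axioms countable_int_forms fm)
    show "norm (f n A) \<le> gaussian_bound \<beta> (fst A) * (\<Prod>p\<in>components 2. exp (- (\<beta> * pi\<^sup>2) * \<bar>n (fst p) (snd p)\<bar>))"
      if "n \<in> int_forms 2" for n A
      unfolding f_def by (rule norm_gaussian_integrand_le[OF \<beta> that])
    show "(\<lambda>n::'n form. \<Prod>p\<in>components 2. exp (- (\<beta> * pi\<^sup>2) * \<bar>n (fst p) (snd p)\<bar>)) summable_on int_forms 2"
      using \<beta> by (intro summable_on_int_forms) simp
  qed (auto intro: prod_nonneg)
  also have "\<dots> = infsum (\<lambda>n. if k n = (\<lambda>_ _. 0) then LINT A|?M1. gaussian_integrand \<beta> \<phi> (\<lambda>_ _ _. 0) (form_of 1 A) (\<lambda>_ _. 0) n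
      else 0) (int_forms 2)"
  proof (rule infsum_cong)
    fix n :: "'n form" assume n: "n \<in> int_forms 2"
    let ?G = "\<lambda>A. gaussian_integrand \<beta> \<phi> (\<lambda>_ _ _. 0) (form_of 1 A) (\<lambda>_ _. 0) n"
    have f_eq: "f n (A, A') = ?G A * exp (\<i> * of_real (form_dot 3 (form_of 3 A') (k n)))" for A A'
      by (simp add: f_def gaussian_integrand_def form_dot_def)
    \<comment> \<open>For Fubini at a fixed \<open>n\<close> it suffices that the Gaussian weight is
      at most 1.\<close>
    have "norm (f n A) \<le> 1" for A
    proof -
      have "form_dot 2 b b \<ge> 0" for b :: "'n form"
        by (auto simp: form_dot_def intro!: sum_nonneg)
      then show ?thesis using \<beta> by (simp add: f_def gaussian_integrand_def norm_mult)
    qed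
    then have "integrable (?M1 \<Otimes>\<^sub>M ?M3) (f n)"
      by (intro P.integrable_const_bound[where B=1] fm[OF n]) auto
    then have "(LINT A|(?M1 \<Otimes>\<^sub>M ?M3). f n A) = (LINT A|?M1. LINT A'|?M3. f n (A, A'))"
      by (rule P.integral_fst'[symmetric])
    also have "\<dots> = (LINT A|?M1. ?G A * (if k n = (\<lambda>_ _. 0) then 1 else 0))"
      unfolding f_eq integral_mult_right_zero integral_gauge_measure_character[OF k[OF n]] ..
    finally show "(LINT A|(?M1 \<Otimes>\<^sub>M ?M3). f n A) = (if k n = (\<lambda>_ _. 0) then LINT A|?M1. ?G A else 0)"
      by simp
  qed
  finally show ?thesis .
qed

text \<open>The phases are compared only where the delta from \<open>Am\<close> is non-zero. The
  factor \<open>c\<close> depends neither on \<open>A\<close> nor on \<open>n\<close>, so it leaves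
  both the integral and the sum.\<close>

lemma path_integral_gaussian_phase:
  assumes "\<beta> > 0"
    and "\<And>n. n \<in> int_forms 2 \<Longrightarrow> (\<lambda>A. \<phi> (form_of 1 A) n) \<in> borel_measurable (gauge_measure 1)"
    and "\<And>n. n \<in> int_forms 2 \<Longrightarrow> (\<lambda>A. \<psi> (form_of 1 A) n) \<in> borel_measurable (gauge_measure 1)"
    and "\<And>n. n \<in> int_forms 2 \<Longrightarrow> k n \<in> int_forms 3"
    and phase: "\<And>n A. n \<in> int_forms 2 \<Longrightarrow> k n = (\<lambda>_ _. 0) \<Longrightarrow> is_form 1 A \<Longrightarrow>
      exp (\<i> * of_real (\<psi> A n)) = c * exp (\<i> * of_real (\<phi> A n))"
  shows "path_integral (gaussian_integrand \<beta> \<psi> k) = c * path_integral (gaussian_integrand \<beta> \<phi> k)"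
proof -
  let ?I = "\<lambda>\<phi> n. if k n = (\<lambda>_ _. 0)
    then LINT A|gauge_measure 1. gaussian_integrand \<beta> \<phi> (\<lambda>_ _ _. 0) (form_of 1 A) (\<lambda>_ _. 0) n else 0"
  have "path_integral (gaussian_integrand \<beta> \<psi> k) = infsum (?I \<psi>) (int_forms 2)"
    by (rule path_integral_gaussian) (use assms in auto)
  also have "\<dots> = infsum (\<lambda>n. c * ?I \<phi> n) (int_forms 2)"
  proof (rule infsum_cong)
    show "?I \<psi> n = c * ?I \<phi> n" if "n \<in> int_forms 2" for n
      using phase[OF that _ is_form_form_of_1]
      by (simp add: gaussian_integrand_def integral_mult_right_zero[symmetric] mult_ac
          del: integral_mult_right_zero)
  qed
  also have "\<dots> = c * infsum (?I \<phi>) (int_forms 2)"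
    by (rule infsum_cmult_right')
  also have "infsum (?I \<phi>) (int_forms 2) = path_integral (gaussian_integrand \<beta> \<phi> k)"
    by (rule path_integral_gaussian[symmetric]) (use assms in auto)
  finally show ?thesis .
qed

section \<open>Correlators as Gaussian path integrals\<close>

lemma path_integral_cong:
  assumes "\<And>Ae Am n. is_form 1 Ae \<Longrightarrow> is_form 3 Am \<Longrightarrow> n \<in> int_forms 2 \<Longrightarrow> f Ae Am n = g Ae Am n"
  shows "path_integral f = path_integral g"
  unfolding path_integral_def
  by (intro Bochner_Integration.integral_cong infsum_cong assms is_form_form_of_1 is_form_form_of_3) auto

lemma exp_ii_period: "exp (\<i> * of_real (x + 2 * pi * of_int m)) = exp (\<i> * of_real x)"
proof -
  have "exp (\<i> * of_real (x + 2 * pi * of_int m)) = exp (\<i> * of_real x) * exp (2 * of_int m * of_real pi * \<i>)"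
    by (simp add: exp_add[symmetric] algebra_simps)
  also have "exp (2 * of_int m * of_real pi * \<i>) = 1"
    using exp_integer_2pi[of "of_int m"] by (simp add: algebra_simps)
  finally show ?thesis by simp
qed

lemma exp_ii_pi_int: "exp (\<i> * of_real (- (pi * of_int m))) = (-1) powi m"
proof -
  have "exp (\<i> * of_real (- (pi * of_int m))) = exp (of_int (- m) * (of_real pi * \<i>))"
    by (simp add: algebra_simps)
  also have "\<dots> = (-1) powi (- m)"
    by (simp only: exp_power_int[symmetric] exp_pi_i)
  finally show ?thesis by (simp add: power_int_minus_one_minus)
qed

lemma form_dot_diff_right:
  "form_dot r a (\<lambda>x \<mu>s. b x \<mu>s - b' x \<mu>s) = form_dot r a b - form_dot r a b'"
  by (simp add: form_dot_def algebra_simps sum_subtractf)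

lemma form_dot_minus_right: "form_dot r a (\<lambda>x \<mu>s. - b x \<mu>s) = - form_dot r a b"
  by (simp add: form_dot_def sum_negf)

lemma int_forms_diff:
  assumes "a \<in> int_forms r" "b \<in> int_forms r"
  shows "(\<lambda>x \<mu>s. a x \<mu>s - b x \<mu>s) \<in> int_forms r"
  using assms is_form_linear[of r a b "-1"] by (auto simp: int_forms_def)

lemma int_forms_scale:
  assumes "a \<in> int_forms r"
  shows "(\<lambda>x \<mu>s. of_int q * a x \<mu>s) \<in> int_forms r"
  using assms by (auto simp: int_forms_def is_form_scale)

text \<open>Summation by parts turns the coupling of \<open>Am\<close> to the field strength into
  minus the coupling to \<open>dn\<close>: the exact part drops out and 2\<pi> cancels. Adding the
  source \<open>d\<close> of the loop gives \<open>d - dn\<close>.\<close>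

lemma correlator_gaussian:
  fixes Q :: "'n::finite form \<Rightarrow> 'n form \<Rightarrow> real"
  assumes W: "\<And>Ae Am. is_form 1 Ae \<Longrightarrow> is_form 3 Am \<Longrightarrow>
      W Ae Am = exp (\<i> * of_real (w Ae + form_dot 3 Am d))"
  shows "correlator Q W p \<beta> \<theta> =
    path_integral (gaussian_integrand \<beta>
      (\<lambda>Ae n. - \<theta> * Q (field_strength Ae n) n - of_int p * pi * pontryagin n + w Ae)
      (\<lambda>n x \<mu>s. d x \<mu>s - ext_d n x \<mu>s)) / partition_function TYPE('n) \<beta> \<theta>"
  unfolding correlator_def Let_def
  by (intro arg_cong2[where f="(/)"] path_integral_cong refl)
    (simp add: W gaussian_integrand_def form_dot_codiff_field_strength form_dot_diff_right
      exp_add[symmetric] algebra_simps)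

lemma partition_function_gaussian:
  "partition_function TYPE('n::finite) \<beta> \<theta> = path_integral (gaussian_integrand \<beta>
      (\<lambda>(Ae :: 'n form) n. - \<theta> / (8 * pi\<^sup>2) * lattice_sum (cup 2 2 (field_strength Ae n) (field_strength Ae n)))
      (\<lambda>n x \<mu>s. 0 - ext_d n x \<mu>s))"
  unfolding partition_function_def Let_def
  by (intro path_integral_cong)
    (simp add: gaussian_integrand_def form_dot_codiff_field_strength form_dot_minus_right
      exp_add[symmetric] algebra_simps)

lemma measurable_lattice_sum_cup_gauge:
  "(\<lambda>A. lattice_sum (cup r t (form_of s A) b)) \<in> borel_measurable (gauge_measure s)"
  "(\<lambda>A. lattice_sum (cup r t b (form_of s A))) \<in> borel_measurable (gauge_measure s)"
  using measurable_form_of unfolding lattice_sum_def cup_def by measurable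

lemma measurable_charges:
  fixes n :: "'n::finite form"
  assumes n: "is_form 2 n"
  shows "(\<lambda>A. lattice_sum (cup 2 2 (field_strength (form_of 1 A) n) (field_strength (form_of 1 A) n)))
      \<in> borel_measurable (gauge_measure 1)"
    and "(\<lambda>A. top_charge (field_strength (form_of 1 A) n) n) \<in> borel_measurable (gauge_measure 1)"
    and "(\<lambda>A. dual_top_charge (field_strength (form_of 1 A) n) n) \<in> borel_measurable (gauge_measure 1)"
proof -
  note [measurable] = measurable_lattice_sum_cup_gauge
  show "(\<lambda>A. lattice_sum (cup 2 2 (field_strength (form_of 1 A) n) (field_strength (form_of 1 A) n)))
      \<in> borel_measurable (gauge_measure 1)"
    unfolding lattice_sum_cup_field_strength[OF is_form_form_of_1 n] by measurable
  have "top_charge (field_strength (form_of 1 A) n) n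
      = (pi * pontryagin n + lattice_sum (cup 1 3 (form_of 1 A) (ext_d n))) / (2 * pi)"
    "dual_top_charge (field_strength (form_of 1 A) n) n = (pi * pontryagin n
      - 2 * pi * lattice_sum (cup1 2 3 n (ext_d n)) - lattice_sum (cup 3 1 (ext_d n) (form_of 1 A))) / (2 * pi)" for A
    unfolding top_charge_eq[OF is_form_form_of_1 n, symmetric] by simp_all
  then show "(\<lambda>A. top_charge (field_strength (form_of 1 A) n) n) \<in> borel_measurable (gauge_measure 1)"
    "(\<lambda>A. dual_top_charge (field_strength (form_of 1 A) n) n) \<in> borel_measurable (gauge_measure 1)"
    by simp_all
qed

text \<open>Needed because the expectation value at \<theta> + 2\<pi> is normalised at \<theta> +
  2\<pi>. Without a loop the constraint is \<open>dn = 0\<close>; then \<open>F \<union> F\<close>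
  sums to \<open>4 * pi\<^sup>2\<close> times an even integer, and the phase changes by a multiple
  of 2\<pi>.\<close>

lemma partition_function_shift:
  assumes "\<beta> > 0"
  shows "partition_function TYPE('n::finite) \<beta> (\<theta> + 2 * pi) = partition_function TYPE('n) \<beta> \<theta>"
proof -
  let ?C = "\<lambda>(A :: 'n form) n. lattice_sum (cup 2 2 (field_strength A n) (field_strength A n))"
  have "partition_function TYPE('n) \<beta> (\<theta> + 2 * pi) = 1 * partition_function TYPE('n) \<beta> \<theta>"
    unfolding partition_function_gaussian
  proof (rule path_integral_gaussian_phase[OF assms])
    fix n :: "'n form" assume n: "n \<in> int_forms 2"
    then have nf: "is_form 2 n" by (simp add: int_forms_def)
    show "(\<lambda>A. - \<theta> / (8 * pi\<^sup>2) * ?C (form_of 1 A) n) \<in> borel_measurable (gauge_measure 1)"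
      "(\<lambda>A. - (\<theta> + 2 * pi) / (8 * pi\<^sup>2) * ?C (form_of 1 A) n) \<in> borel_measurable (gauge_measure 1)"
      using measurable_charges(1)[OF nf] by (auto intro!: borel_measurable_times)
    have "(\<lambda>_ _. 0) \<in> int_forms 3" by (simp add: int_forms_def is_form_zero)
    from int_forms_diff[OF this ext_d_in_int_forms[OF n]]
    show "(\<lambda>x \<mu>s. 0 - ext_d n x \<mu>s) \<in> int_forms 3" .
    fix A :: "'n form" assume "(\<lambda>x \<mu>s. 0 - ext_d n x \<mu>s) = (\<lambda>_ _. 0)" and A: "is_form 1 A"
    then have dn: "ext_d n = (\<lambda>_ _. 0)" by (simp add: fun_eq_iff)
    obtain k where k: "lattice_sum (cup 2 2 n n) = 2 * of_int k"
      using even_lattice_sum_cup_closed[OF n dn] .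
    have "lattice_sum (cup 1 3 A (\<lambda>_ _. 0)) = 0" "lattice_sum (cup 3 1 (\<lambda>_ _. 0) A) = 0"
      by (simp_all add: lattice_sum_cup_1_3 lattice_sum_cup_3_1 is_form_zero corr_zero del: One_nat_def)
    then have C: "?C A n = 8 * pi\<^sup>2 * of_int k"
      unfolding lattice_sum_cup_field_strength[OF A nf] by (simp add: dn k)
    have "- (\<theta> + 2 * pi) / (8 * pi\<^sup>2) * ?C A n = - \<theta> / (8 * pi\<^sup>2) * ?C A n + 2 * pi * of_int (- k)"
      unfolding C by (simp add: field_simps)
    then show "exp (\<i> * of_real (- (\<theta> + 2 * pi) / (8 * pi\<^sup>2) * ?C A n))
        = 1 * exp (\<i> * of_real (- \<theta> / (8 * pi\<^sup>2) * ?C A n))"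
      by (simp only: exp_ii_period mult_1_left)
  qed
  then show ?thesis by simp
qed

text \<open>Serves both loops: \<open>l\<close> stands for the given form or its diagonal translate,
  \<open>g\<close> for the loop, and the integer in the assumption on \<open>Q\<close> absorbs the
  \<open>cup1\<close> term of the dual charge. The extra phase 2\<pi>Q supplies the step from
  \<open>p\<close> to \<open>p + 1\<close> and the missing electric charge at once.\<close>

lemma loop_correlator_shift:
  fixes Q :: "'n::finite form \<Rightarrow> 'n form \<Rightarrow> real" and l :: "'n form"
  assumes \<beta>: "\<beta> > 0" and l: "l \<in> int_forms 2" and v: "of_int v = pontryagin l"
    and meas: "\<And>n. is_form 2 n \<Longrightarrow>
      (\<lambda>A. Q (field_strength (form_of 1 A) n) n) \<in> borel_measurable (gauge_measure 1)"
    and Q: "\<And>A n. is_form 1 A \<Longrightarrow> n \<in> int_forms 2 \<Longrightarrow>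
      ext_d n = (\<lambda>x \<mu>s. of_int qm * ext_d l x \<mu>s) \<Longrightarrow>
      \<exists>m::int. 2 * pi * Q (field_strength A n) n
        = pi * pontryagin n - of_int qm * form_dot 1 g A + 2 * pi * of_int m"
    and W: "\<And>q Ae Am. is_form 1 Ae \<Longrightarrow> is_form 3 Am \<Longrightarrow> W q Ae Am =
      exp (\<i> * of_real (of_int q * form_dot 1 g Ae + form_dot 3 Am (\<lambda>x \<mu>s. of_int qm * ext_d l x \<mu>s)))"
  shows "correlator Q (W (qe - qm)) p \<beta> (\<theta> + 2 * pi) = correlator Q (W qe) (p + 1) \<beta> \<theta>"
    and "correlator Q (W qe) (p + 1) \<beta> \<theta> = (-1) powi (qm\<^sup>2 * v) * correlator Q (W qe) p \<beta> \<theta>"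
proof -
  let ?d = "\<lambda>x \<mu>s. of_int qm * ext_d l x \<mu>s"
  let ?k = "\<lambda>n x \<mu>s. ?d x \<mu>s - ext_d n x \<mu>s"
  define \<phi> where "\<phi> \<theta> p q A n = - \<theta> * Q (field_strength A n) n - of_int p * pi * pontryagin n
      + of_int q * form_dot 1 g A" for \<theta> :: real and p q :: int and A n :: "'n form"
  have corr: "correlator Q (W q) p \<beta> \<theta> = path_integral (gaussian_integrand \<beta> (\<phi> \<theta> p q) ?k)
      / partition_function TYPE('n) \<beta> \<theta>" for q p \<theta>
    unfolding \<phi>_def by (rule correlator_gaussian) (rule W)
  have \<phi>_meas: "(\<lambda>A. \<phi> \<theta> p q (form_of 1 A) n) \<in> borel_measurable (gauge_measure 1)"
    if "n \<in> int_forms 2" for n \<theta> p q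
  proof -
    have [measurable]: "(\<lambda>A. Q (field_strength (form_of 1 A) n) n) \<in> borel_measurable (gauge_measure 1)"
      using that by (intro meas) (simp add: int_forms_def)
    note [measurable] = measurable_form_of
    show ?thesis unfolding \<phi>_def form_dot_def by measurable
  qed
  have k: "?k n \<in> int_forms 3" if "n \<in> int_forms 2" for n
    using that l by (intro int_forms_diff int_forms_scale ext_d_in_int_forms)
  have dn: "ext_d n = ?d" if "?k n = (\<lambda>_ _. 0)" for n
    using that by (simp add: fun_eq_iff)
  have "path_integral (gaussian_integrand \<beta> (\<phi> (\<theta> + 2 * pi) p (qe - qm)) ?k)
      = 1 * path_integral (gaussian_integrand \<beta> (\<phi> \<theta> (p + 1) qe) ?k)"
  proof (rule path_integral_gaussian_phase[OF \<beta> \<phi>_meas \<phi>_meas k])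
    fix n A :: "'n form"
    assume n: "n \<in> int_forms 2" and "?k n = (\<lambda>_ _. 0)" and A: "is_form 1 A"
    from Q[OF A n dn[OF this(2)]] obtain m :: int where
      m: "2 * pi * Q (field_strength A n) n = pi * pontryagin n - of_int qm * form_dot 1 g A + 2 * pi * of_int m" ..
    have "\<phi> (\<theta> + 2 * pi) p (qe - qm) A n = - \<theta> * Q (field_strength A n) n - 2 * pi * Q (field_strength A n) n
        - of_int p * pi * pontryagin n + of_int (qe - qm) * form_dot 1 g A"
      by (simp add: \<phi>_def algebra_simps)
    also have "\<dots> = \<phi> \<theta> (p + 1) qe A n + 2 * pi * of_int (- m)"
      unfolding m by (simp add: \<phi>_def algebra_simps)
    finally show "exp (\<i> * of_real (\<phi> (\<theta> + 2 * pi) p (qe - qm) A n)) = 1 * exp (\<i> * of_real (\<phi> \<theta> (p + 1) qe A n))"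
      by (simp only: exp_ii_period mult_1_left)
  qed auto
  then show "correlator Q (W (qe - qm)) p \<beta> (\<theta> + 2 * pi) = correlator Q (W qe) (p + 1) \<beta> \<theta>"
    unfolding corr partition_function_shift[OF \<beta>] by simp
  have "path_integral (gaussian_integrand \<beta> (\<phi> \<theta> (p + 1) qe) ?k)
      = (-1) powi (qm\<^sup>2 * v) * path_integral (gaussian_integrand \<beta> (\<phi> \<theta> p qe) ?k)"
  proof (rule path_integral_gaussian_phase[OF \<beta> \<phi>_meas \<phi>_meas k])
    fix n A :: "'n form"
    assume n: "n \<in> int_forms 2" and "?k n = (\<lambda>_ _. 0)" and A: "is_form 1 A"
    obtain j where j: "pontryagin n = of_int (qm\<^sup>2) * pontryagin l + 2 * of_int j"
      using pontryagin_mod_two[OF n l dn[OF \<open>?k n = _\<close>]] .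
    \<comment> \<open>Modulo 2\<pi> the additional phase no longer depends on \<open>n\<close>,
      which makes it a global sign.\<close>
    have "\<phi> \<theta> (p + 1) qe A n = (\<phi> \<theta> p qe A n + - (pi * of_int (qm\<^sup>2 * v))) + 2 * pi * of_int (- j)"
      using arg_cong[OF j, of "\<lambda>x. pi * x"] by (simp add: \<phi>_def v[symmetric] algebra_simps)
    then have "exp (\<i> * of_real (\<phi> \<theta> (p + 1) qe A n)) = exp (\<i> * of_real (\<phi> \<theta> p qe A n + - (pi * of_int (qm\<^sup>2 * v))))"
      by (simp only: exp_ii_period)
    also have "\<dots> = exp (\<i> * of_real (\<phi> \<theta> p qe A n)) * exp (\<i> * of_real (- (pi * of_int (qm\<^sup>2 * v))))"
      by (simp only: exp_add[symmetric] of_real_add distrib_left)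
    finally show "exp (\<i> * of_real (\<phi> \<theta> (p + 1) qe A n)) = (-1) powi (qm\<^sup>2 * v) * exp (\<i> * of_real (\<phi> \<theta> p qe A n))"
      by (simp only: exp_ii_pi_int mult.commute)
  qed auto
  then show "correlator Q (W qe) (p + 1) \<beta> \<theta> = (-1) powi (qm\<^sup>2 * v) * correlator Q (W qe) p \<beta> \<theta>"
    unfolding corr by simp
qed

lemma form_dot_scale_right: "form_dot r a (\<lambda>x \<mu>s. k * b x \<mu>s) = k * form_dot r a b"
  by (simp add: form_dot_def sum_distrib_left mult.left_commute)

theorem lemma1:
  fixes \<gamma> :: "('n::finite) link list" and l :: "'n form" and v :: int
    and \<beta> \<theta> :: real and p qe qm :: int
  assumes "closed_loop \<gamma>"
    and "bounds_surface \<gamma>"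
    and "l \<in> int_forms 2"
    and "dual_to_loop l \<gamma>"
    and "of_int v = pontryagin l"
    and "\<beta> > 0"
  shows "dyonic_vev (qe - qm) qm \<gamma> p \<beta> (\<theta> + 2 * pi) = dyonic_vev qe qm \<gamma> (p + 1) \<beta> \<theta> \<and>
         dyonic_vev qe qm \<gamma> (p + 1) \<beta> \<theta> = (-1) powi (qm\<^sup>2 * v) * dyonic_vev qe qm \<gamma> p \<beta> \<theta> \<and>
         dual_dyonic_vev (qe - qm) qm \<gamma> p \<beta> (\<theta> + 2 * pi)
           = dual_dyonic_vev qe qm \<gamma> (p + 1) \<beta> \<theta> \<and>
         dual_dyonic_vev qe qm \<gamma> (p + 1) \<beta> \<theta>
           = (-1) powi (qm\<^sup>2 * v) * dual_dyonic_vev qe qm \<gamma> p \<beta> \<theta>"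
proof -
  note l = \<open>l \<in> int_forms 2\<close> and dual = \<open>dual_to_loop l \<gamma>\<close> and v = \<open>of_int v = pontryagin l\<close> and \<beta> = \<open>\<beta> > 0\<close>
  have lf: "is_form 2 l" using l by (simp add: int_forms_def)
  note charge = loop_cup_charge[OF lf dual]
  let ?l = "diagonal_translate l"
  have Q: "\<exists>m::int. 2 * pi * top_charge (field_strength A n) n
      = pi * pontryagin n - of_int qm * form_dot 1 (loop_form \<gamma>) A + 2 * pi * of_int m"
    if "is_form 1 A" "n \<in> int_forms 2" "ext_d n = (\<lambda>x \<mu>s. of_int qm * ext_d l x \<mu>s)" for A n
    using that top_charge_eq(1)[of A n] charge(3)[of A "of_int qm"]
    by (intro exI[of _ 0]) (simp add: int_forms_def)
  have dual_Q: "\<exists>m::int. 2 * pi * dual_top_charge (field_strength A n) n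
      = pi * pontryagin n - of_int qm * form_dot 1 (loop_form \<gamma>) A + 2 * pi * of_int m"
    if A: "is_form 1 A" and n: "n \<in> int_forms 2" and dn: "ext_d n = (\<lambda>x \<mu>s. of_int qm * ext_d ?l x \<mu>s)" for A n
  proof -
    \<comment> \<open>For integer \<open>n\<close> the \<open>cup1\<close> term in the dual charge
      contributes a multiple of 2\<pi>; it enters with a minus sign, hence the witness
      \<open>- m\<close>.\<close>
    obtain m where "lattice_sum (cup1 2 3 n (ext_d n)) = of_int m"
      using lattice_sum_cup1_in_Ints[OF n ext_d_in_int_forms[OF n]] by (rule Ints_cases)
    then show ?thesis
      using n top_charge_eq(2)[OF A, of n] charge(4)[of "of_int qm" A] dn
      by (intro exI[of _ "- m"]) (simp add: int_forms_def ext_d_diagonal_translate)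
  qed
  have W: "dyonic_loop q qm \<gamma> Ae Am = exp (\<i> * of_real (of_int q * form_dot 1 (loop_form \<gamma>) Ae
      + form_dot 3 Am (\<lambda>x \<mu>s. of_int qm * ext_d l x \<mu>s)))" if "is_form 3 Am" for q Ae Am
    using charge(1)[OF that] by (simp add: dyonic_loop_def form_dot_scale_right)
  have dual_W: "dual_dyonic_loop q qm \<gamma> Ae Am = exp (\<i> * of_real (of_int q * form_dot 1 (loop_form \<gamma>) Ae
      + form_dot 3 Am (\<lambda>x \<mu>s. of_int qm * ext_d ?l x \<mu>s)))" if "is_form 3 Am" for q Ae Am
    using charge(2)[OF that]
    by (simp add: dual_dyonic_loop_def form_dot_scale_right ext_d_diagonal_translate)
  \<comment> \<open>The Pontryagin square is translation invariant, so the same \<open>v\<close>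
    serves both loops.\<close>
  have dual_v: "of_int v = pontryagin ?l" by (simp add: pontryagin_diagonal_translate[OF lf] v)
  note shift = loop_correlator_shift[where Q=top_charge and l=l and v=v and \<beta>=\<beta> and qm=qm
      and W="\<lambda>q. dyonic_loop q qm \<gamma>" and g="loop_form \<gamma>"]
  note dual_shift = loop_correlator_shift[where Q=dual_top_charge and l="?l" and v=v and \<beta>=\<beta> and qm=qm
      and W="\<lambda>q. dual_dyonic_loop q qm \<gamma>" and g="loop_form \<gamma>"]
  have "dyonic_vev (qe - qm) qm \<gamma> p \<beta> (\<theta> + 2 * pi) = dyonic_vev qe qm \<gamma> (p + 1) \<beta> \<theta>"
    "dyonic_vev qe qm \<gamma> (p + 1) \<beta> \<theta> = (-1) powi (qm\<^sup>2 * v) * dyonic_vev qe qm \<gamma> p \<beta> \<theta>"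
    unfolding dyonic_vev_def
    by (rule shift; (rule \<beta> l v measurable_charges(2) Q W; assumption))+
  moreover have "dual_dyonic_vev (qe - qm) qm \<gamma> p \<beta> (\<theta> + 2 * pi) = dual_dyonic_vev qe qm \<gamma> (p + 1) \<beta> \<theta>"
    "dual_dyonic_vev qe qm \<gamma> (p + 1) \<beta> \<theta> = (-1) powi (qm\<^sup>2 * v) * dual_dyonic_vev qe qm \<gamma> p \<beta> \<theta>"
    unfolding dual_dyonic_vev_def
    by (rule dual_shift;
        (rule \<beta> diagonal_translate_int_forms[OF l] dual_v measurable_charges(3) dual_Q dual_W; assumption))+
  ultimately show ?thesis by blast
qed

end
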